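(* There is an absolute constant $C>0$ such that the following holds. Let $f\in\mathscr{S}'(\mathbb{R}^2)$ and $g\in\mathscr{S}(\mathbb{R}^2)$, with $\operatorname{supp}f\subset A_j$ for some integer $j\ge0$, and let $\Omega\subset\mathbb{R}^2$ have positive measure. Let $$K_4:=\inf\{|\xi_1+\xi|:\exists\,\tau,\tau_1\text{ s.t. }(\tau,\xi)\in\Omega,\ (\tau_1,\xi_1)\in\operatorname{supp}f\}\ge2.$$ If for all $(\tau,\xi)\in\Omega$, $(\tau_1,\xi_1)\in\operatorname{supp}f$, with $\xi_2=\xi-\xi_1$, $$\xi\xi_1\le0\quad\text{and}\quad\Big|1+\frac{4}{3\xi\xi_1\xi_2^2}\Big|\le\frac12,$$ then for any integer $k\ge0$, $$\|f*g\|_{L^2(B_k)}\le C2^{k/4}\|f\|_{\hat X^{0,\frac12,1}}\big\||\xi|^{-1/4}g\big\|_{L^2(\mathbb{R}^2)},$$ $$\|f*g\|_{L^2(\Omega\cap B_k)}\le C2^{k/2}K_4^{-1/2}\|f\|_{\hat X^{0,\frac12,1}}\big\||\xi|^{-1/2}g\big\|_{L^2(\mathbb{R}^2)}.$$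
   Context: Points of $\mathbb{R}^2$ are written $(\tau,\xi)$; $f,g$ are functions (distributions) of $(\tau,\xi)$ and $*$ is convolution on $\mathbb{R}^2$. $\langle x\rangle=1+|x|$. For integers $j,k\ge0$, $$A_j=\{(\tau,\xi):2^j\le\langle\xi\rangle<2^{j+1}\},\qquad B_k=\{(\tau,\xi):2^k\le\langle\tau-\xi^3+\tfrac1\xi\rangle<2^{k+1}\},$$ $$\|f\|_{\hat X^{s,b,1}}=\Big[\sum_{j\ge0}\Big(\sum_{k\ge0}\big\|\langle\xi\rangle^s\langle\tau-\xi^3+\tfrac1\xi\rangle^bf\big\|_{L^2_{\tau\xi}(A_j\cap B_k)}\Big)^2\Big]^{1/2}.$$ The estimates are understood when the right-hand sides are finite. The condition on $1+\frac{4}{3\xi\xi_1\xi_2^2}$ is imposed at points where this expression is defined. *)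

theory Defs
  imports "HOL-Analysis.Analysis"
begin

section \<open>Schwartz functions and tempered distributions\<close>

text \<open>Iterated directional derivative along the vectors of a list, the head being applied last.\<close>

primrec dir_derivs :: "'a::real_normed_vector list \<Rightarrow> ('a \<Rightarrow> complex) \<Rightarrow> 'a \<Rightarrow> complex" where
  "dir_derivs [] \<phi> = \<phi>"
| "dir_derivs (v # vs) \<phi> = (\<lambda>z. frechet_derivative (dir_derivs vs \<phi>) (at z) v)"

definition schwartz :: "('a::euclidean_space \<Rightarrow> complex) \<Rightarrow> bool" where
  "schwartz \<phi> \<longleftrightarrow>
     (\<forall>vs\<in>lists Basis.
        (\<forall>z. dir_derivs vs \<phi> differentiable (at z)) \<and>
        (\<forall>N::nat. bounded (range (\<lambda>z. (1 + norm z) ^ N *\<^sub>R dir_derivs vs \<phi> z))))"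

definition schwartz_seminorm :: "nat \<Rightarrow> ('a::euclidean_space \<Rightarrow> complex) \<Rightarrow> real" where
  "schwartz_seminorm N \<phi> =
     (\<Sum>vs | vs \<in> lists Basis \<and> length vs \<le> N.
        SUP z. (1 + norm z) ^ N * cmod (dir_derivs vs \<phi> z))"

text \<open>A tempered distribution is a continuous linear functional on the Schwartz space. It is
  modelled by a functional on all functions, of which only the values at Schwartz functions
  matter. The seminorms above increase with \<open>N\<close> and generate the topology, so continuity is
  domination by one of them. The pairing is bilinear (no complex conjugation).\<close>

definition tempered_distribution :: "(('a::euclidean_space \<Rightarrow> complex) \<Rightarrow> complex) \<Rightarrow> bool" where
  "tempered_distribution u \<longleftrightarrow>
     (\<forall>\<phi> \<psi>. schwartz \<phi> \<longrightarrow> schwartz \<psi> \<longrightarrow> u (\<lambda>z. \<phi> z + \<psi> z) = u \<phi> + u \<psi>) \<and>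
     (\<forall>c \<phi>. schwartz \<phi> \<longrightarrow> u (\<lambda>z. c * \<phi> z) = c * u \<phi>) \<and>
     (\<exists>C N. \<forall>\<phi>. schwartz \<phi> \<longrightarrow> cmod (u \<phi>) \<le> C * schwartz_seminorm N \<phi>)"

definition fun_support :: "('a::topological_space \<Rightarrow> complex) \<Rightarrow> 'a set" where
  "fun_support \<phi> = closure {z. \<phi> z \<noteq> 0}"

text \<open>The complement of the set of points that have an open neighbourhood on which the
  distribution vanishes.\<close>

definition dist_support :: "(('a::euclidean_space \<Rightarrow> complex) \<Rightarrow> complex) \<Rightarrow> 'a set" where
  "dist_support u =
     {z. \<forall>U. open U \<and> z \<in> U \<longrightarrow>
           (\<exists>\<phi>. schwartz \<phi> \<and> compact (fun_support \<phi>) \<and> fun_support \<phi> \<subseteq> U \<and> u \<phi> \<noteq> 0)}"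

definition dist_conv ::
    "(('a::euclidean_space \<Rightarrow> complex) \<Rightarrow> complex) \<Rightarrow> ('a \<Rightarrow> complex) \<Rightarrow> 'a \<Rightarrow> complex" where
  "dist_conv u g z = u (\<lambda>w. g (z - w))"

definition represents :: "('a::euclidean_space \<Rightarrow> complex) \<Rightarrow> (('a \<Rightarrow> complex) \<Rightarrow> complex) \<Rightarrow> bool" where
  "represents F u \<longleftrightarrow>
     F \<in> borel_measurable lebesgue \<and>
     (\<forall>\<phi>. schwartz \<phi> \<longrightarrow>
        integrable lebesgue (\<lambda>z. F z * \<phi> z) \<and> u \<phi> = (\<integral>z. F z * \<phi> z \<partial>lebesgue))"


section \<open>Norms with values in the extended nonnegative reals\<close>

definition enn_sqrt :: "ennreal \<Rightarrow> ennreal" where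
  "enn_sqrt x = (if x = \<infinity> then \<infinity> else ennreal (sqrt (enn2real x)))"

definition L2_norm_on :: "'a::euclidean_space set \<Rightarrow> ('a \<Rightarrow> complex) \<Rightarrow> ennreal" where
  "L2_norm_on S h = enn_sqrt (\<integral>\<^sup>+z\<in>S. (ennreal (cmod (h z)))\<^sup>2 \<partial>lebesgue)"

text \<open>Points of the plane are pairs \<open>(\<tau>, \<xi>)\<close>. The division by zero in the modulation and in the
  powers of \<open>\<bar>\<xi>\<bar>\<close> below only concerns the null line \<open>\<xi> = 0\<close>, which does not affect
  the norms.\<close>

definition jb :: "real \<Rightarrow> real" where
  "jb x = 1 + \<bar>x\<bar>"

definition modulation :: "real \<Rightarrow> real \<Rightarrow> real" where
  "modulation \<tau> \<xi> = \<tau> - \<xi> ^ 3 + 1 / \<xi>"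

definition A_set :: "nat \<Rightarrow> (real \<times> real) set" where
  "A_set j = {(\<tau>, \<xi>). 2 ^ j \<le> jb \<xi> \<and> jb \<xi> < 2 ^ (j + 1)}"

definition B_set :: "nat \<Rightarrow> (real \<times> real) set" where
  "B_set k = {(\<tau>, \<xi>). 2 ^ k \<le> jb (modulation \<tau> \<xi>) \<and> jb (modulation \<tau> \<xi>) < 2 ^ (k + 1)}"

definition Xhat_norm_fun :: "real \<Rightarrow> real \<Rightarrow> (real \<times> real \<Rightarrow> complex) \<Rightarrow> ennreal" where
  "Xhat_norm_fun s b F =
     enn_sqrt (\<Sum>j. (\<Sum>k. L2_norm_on (A_set j \<inter> B_set k)
       (\<lambda>(\<tau>, \<xi>). of_real (jb \<xi> powr s * jb (modulation \<tau> \<xi>) powr b) * F (\<tau>, \<xi>)))\<^sup>2)"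

text \<open>A representing function is unique up to null sets, so the infimum below is the norm of
  that function; it is \<open>\<infinity>\<close> if the distribution is not given by a function.\<close>

definition Xhat_norm :: "real \<Rightarrow> real \<Rightarrow> ((real \<times> real \<Rightarrow> complex) \<Rightarrow> complex) \<Rightarrow> ennreal" where
  "Xhat_norm s b u = (INF F\<in>{F. represents F u}. Xhat_norm_fun s b F)"

definition weight_xi :: "real \<Rightarrow> (real \<times> real \<Rightarrow> complex) \<Rightarrow> real \<times> real \<Rightarrow> complex" where
  "weight_xi a g = (\<lambda>(\<tau>, \<xi>). of_real (\<bar>\<xi>\<bar> powr a) * g (\<tau>, \<xi>))"

text \<open>The infimum is taken in the extended nonnegative reals, hence is \<open>\<infinity>\<close> when \<open>S\<close> is
  empty.\<close>

definition K4 :: "(real \<times> real) set \<Rightarrow> (real \<times> real) set \<Rightarrow> ennreal" where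
  "K4 \<Omega> S = Inf {ennreal \<bar>\<xi>\<^sub>1 + \<xi>\<bar> | \<xi> \<xi>\<^sub>1. \<exists>\<tau> \<tau>\<^sub>1. (\<tau>, \<xi>) \<in> \<Omega> \<and> (\<tau>\<^sub>1, \<xi>\<^sub>1) \<in> S}"

end

theory Submission
  imports Defs "HOL-Computational_Algebra.Polynomial"
begin

text \<open>Write \<open>phase \<xi> = \<xi> ^ 3 - 1 / \<xi>\<close>, so that the modulation of \<open>(\<tau>, \<xi>)\<close> is \<open>\<tau> - phase \<xi>\<close>, and let
  \<open>F\<close> be the function that represents \<open>f\<close>.

  Reduction to a measure. For the part of \<open>F\<close> in \<open>B_set l\<close>, the Cauchy-Schwarz inequality in the
  convolution variable at each fixed output point, followed by Tonelli's theorem, bounds the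
  \<open>L\<^sup>2\<close> norm of the convolution over a set \<open>D\<close>. What remains is, for each \<open>(\<tau>\<^sub>2, \<xi>\<^sub>2)\<close>, the measure
  of the set of \<open>w\<close> in \<open>dist_support f \<inter> B_set l\<close> with \<open>w + (\<tau>\<^sub>2, \<xi>\<^sub>2)\<close> in \<open>D\<close>. A second
  Cauchy-Schwarz inequality, over \<open>l\<close>, adds up the parts; the factor \<open>2 ^ l\<close> that the measure may
  cost is exactly what the weight of the norm with \<open>b = 1/2\<close> pays for. This is
  \<open>convolution_bound_dyadic\<close>, and \<open>weighted_convolution_estimate\<close> in the notation of the problem.

  The measure. If \<open>D \<subseteq> B_set k\<close>, the two modulation conditions put \<open>w = (\<tau>, \<xi>)\<close>, for given \<open>\<xi>\<close>,
  into an interval of length about \<open>2 ^ min k l\<close>, and force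
  \<open>phase (\<xi> + \<xi>\<^sub>2) - phase \<xi>\<close> to lie within about \<open>2 ^ max k l\<close> of \<open>\<tau>\<^sub>2\<close>. So sublevel sets of
  this phase difference have to be small. With \<open>p x = x * (x + \<xi>\<^sub>2)\<close>, the product of the input and the
  output frequency, two values of the phase difference differ by
  \<open>\<xi>\<^sub>2 * (x - y) * (x + y + \<xi>\<^sub>2) * (3 - 1 / (p x * p y))\<close> (\<open>phase_gap_diff\<close>). There are two sources
  of degeneracy, the vertex \<open>2 * x + \<xi>\<^sub>2 = 0\<close> and the critical value \<open>3 * (p x)\<^sup>2 = 1\<close>. One of them
  alone leaves a quadratic lower bound in \<open>\<bar>x - y\<bar>\<close>, hence a square root in the measure; they
  coincide only for \<open>\<bar>x\<bar> = 3 powr (-1/4)\<close>.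

  The hypotheses on \<open>\<Omega>\<close>. They force the product of the two frequencies times \<open>\<xi>\<^sub>2\<^sup>2\<close> to be zero or of
  size one while \<open>\<bar>\<xi>\<^sub>1 + \<xi>\<bar> \<ge> 2\<close>; hence one of the frequencies is small and the other is large.
  Already one point of \<open>\<Omega>\<close> off the line \<open>\<xi> = 0\<close> keeps the support of \<open>f\<close> out of
  \<open>1/3 < \<bar>\<xi>\<^sub>1\<bar> < 2\<close> (\<open>resonance_frequency_gap\<close>), which excludes the doubly degenerate point and
  gives the first estimate, over all of \<open>B_set k\<close>. For output points in \<open>\<Omega>\<close> one has moreover
  \<open>\<bar>p x\<bar> \<le> 1/2\<close>, away from the critical value, and \<open>\<bar>2 * x + \<xi>\<^sub>2\<bar> \<ge> K4\<close>; the phase difference then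
  expands distances at a definite rate on either side of the vertex, which gives the second estimate.

  The passage from \<open>f\<close> to \<open>F\<close>. That \<open>F\<close> vanishes almost everywhere off \<open>dist_support f\<close>, and that
  any two representing functions agree almost everywhere (so that the infimum in \<open>Xhat_norm\<close> is
  attained), both come from the fundamental lemma of the calculus of variations, tested against the
  bump functions of the first section.\<close>


section \<open>Smooth bump functions on boxes\<close>

text \<open>The functions \<open>q (1 / x) * exp (- 1 / x)\<close>, extended by zero to \<open>x \<le> 0\<close>, for all polynomials \<open>q\<close>:
  a family that contains the standard flat function and is closed under differentiation,
  so that smoothness needs no induction on the order of the derivative.\<close>

definition flat_fun :: "real poly \<Rightarrow> real \<Rightarrow> real" where
  "flat_fun q x = (if x > 0 then poly q (1 / x) * exp (- (1 / x)) else 0)"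

definition flat_deriv :: "real poly \<Rightarrow> real poly" where
  "flat_deriv q = [:0, 0, 1:] * (q - pderiv q)"

lemma flat_fun_smult: "flat_fun (smult c q) x = c * flat_fun q x"
  by (simp add: flat_fun_def)

text \<open>With \<open>t = 1 / x\<close> this is the decay of \<open>poly q t * exp (- t)\<close> as \<open>t\<close> tends to infinity.\<close>

lemma flat_fun_tendsto_0: "(flat_fun q \<longlongrightarrow> 0) (at 0)"
proof -
  have mono: "((\<lambda>t. poly q t * exp (- t)) \<longlongrightarrow> 0) at_top"
  proof -
    have "((\<lambda>t. \<Sum>i\<le>degree q. coeff q i * (t ^ i / exp t)) \<longlongrightarrow> (\<Sum>i\<le>degree q. coeff q i * 0)) at_top"
      by (intro tendsto_sum tendsto_mult tendsto_const tendsto_power_div_exp_0)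
    then show ?thesis
      by (simp add: poly_altdef exp_minus sum_distrib_right divide_inverse mult.assoc)
  qed
  have R: "(flat_fun q \<longlongrightarrow> 0) (at_right 0)"
  proof (rule Lim_transform_eventually)
    show "((\<lambda>x. poly q (inverse x) * exp (- inverse x)) \<longlongrightarrow> 0) (at_right 0)"
      by (rule filterlim_compose[OF mono filterlim_inverse_at_top_right])
    show "\<forall>\<^sub>F x in at_right 0. poly q (inverse x) * exp (- inverse x) = flat_fun q x"
      by (auto simp: eventually_at_right_less flat_fun_def inverse_eq_divide intro: eventually_mono[OF eventually_at_right_less])
  qed
  have "(flat_fun q \<longlongrightarrow> 0) (at_left 0)"
    by (rule Lim_transform_eventually[OF tendsto_const])
       (auto simp: flat_fun_def eventually_at_filter)
  with R show ?thesis
    by (simp add: filterlim_split_at)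
qed

text \<open>Away from the origin this is the product and chain rule. At the origin the difference quotient of
  \<open>flat_fun q\<close> is \<open>flat_fun (pCons 0 q)\<close>, which tends to zero.\<close>

lemma flat_fun_has_field_derivative:
  "(flat_fun q has_field_derivative flat_fun (flat_deriv q) x) (at x)"
proof -
  consider "x < 0" | "x = 0" | "x > 0" by linarith
  then show ?thesis
  proof cases
    case 1
    have "((\<lambda>_. 0) has_field_derivative 0) (at x)" by simp
    then have "(flat_fun q has_field_derivative 0) (at x)"
      by (rule has_field_derivative_transform_within[where d = "-x"]) (use 1 in \<open>auto simp: flat_fun_def dist_real_def\<close>)
    then show ?thesis using 1 by (simp add: flat_fun_def)
  next
    case 2
    have "((\<lambda>h. (flat_fun q (0 + h) - flat_fun q 0) / h) \<longlongrightarrow> 0) (at 0)"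
      by (rule Lim_transform_eventually[OF flat_fun_tendsto_0[of "pCons 0 q"]])
         (auto simp: flat_fun_def eventually_at_filter)
    then show ?thesis using 2 by (simp add: DERIV_def flat_fun_def)
  next
    case 3
    have inv: "((\<lambda>x. 1 / x) has_field_derivative - ((1 / x)\<^sup>2)) (at x)"
      using 3 by (auto intro!: derivative_eq_intros simp: power2_eq_square)
    have "((\<lambda>x. poly q (1 / x) * exp (- (1 / x))) has_field_derivative
        (poly (pderiv q) (1 / x) * - ((1 / x)\<^sup>2)) * exp (- (1 / x)) +
        (exp (- (1 / x)) * - (- ((1 / x)\<^sup>2))) * poly q (1 / x)) (at x)"
      by (intro DERIV_mult DERIV_chain2[OF poly_DERIV] DERIV_chain2[OF DERIV_exp] DERIV_minus inv)
    also have "(poly (pderiv q) (1 / x) * - ((1 / x)\<^sup>2)) * exp (- (1 / x)) +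
        (exp (- (1 / x)) * - (- ((1 / x)\<^sup>2))) * poly q (1 / x) = flat_fun (flat_deriv q) x"
      using 3 by (simp add: flat_fun_def flat_deriv_def algebra_simps power2_eq_square)
    finally have "((\<lambda>x. poly q (1 / x) * exp (- (1 / x))) has_field_derivative
        flat_fun (flat_deriv q) x) (at x)" .
    then show ?thesis
      by (rule has_field_derivative_transform_within[where d = x]) (use 3 in \<open>auto simp: flat_fun_def dist_real_def\<close>)
  qed
qed

text \<open>With the affine functions that define the faces of a box, this is a smooth function supported in
  the box.\<close>

definition flat_prod ::
    "'i set \<Rightarrow> ('i \<Rightarrow> real) \<Rightarrow> ('i \<Rightarrow> 'a::euclidean_space) \<Rightarrow> ('i \<Rightarrow> real poly) \<Rightarrow> 'a \<Rightarrow> complex" where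
  "flat_prod I \<alpha> \<beta> q z = complex_of_real (\<Prod>i\<in>I. flat_fun (q i) (\<alpha> i + \<beta> i \<bullet> z))"

text \<open>The additive closure of the products; unlike the products alone it is stable under partial
  derivatives, by the Leibniz rule.\<close>

inductive_set flat_sums :: "'i set \<Rightarrow> ('i \<Rightarrow> real) \<Rightarrow> ('i \<Rightarrow> 'a::euclidean_space) \<Rightarrow> ('a \<Rightarrow> complex) set"
  for I \<alpha> \<beta> where
  zero: "(\<lambda>z. 0) \<in> flat_sums I \<alpha> \<beta>"
| add: "h \<in> flat_sums I \<alpha> \<beta> \<Longrightarrow> (\<lambda>z. flat_prod I \<alpha> \<beta> q z + h z) \<in> flat_sums I \<alpha> \<beta>"

lemma flat_sums_add:
  assumes "h \<in> flat_sums I \<alpha> \<beta>" "h' \<in> flat_sums I \<alpha> \<beta>"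
  shows "(\<lambda>z. h z + h' z) \<in> flat_sums I \<alpha> \<beta>"
  using assms(1)
proof induction
  case zero
  then show ?case using assms(2) by simp
next
  case (add h q)
  from flat_sums.add[OF add.IH, of q] show ?case by (simp add: add.assoc)
qed

lemma flat_sums_flat_prod: "flat_prod I \<alpha> \<beta> q \<in> flat_sums I \<alpha> \<beta>"
  using flat_sums.add[OF flat_sums.zero, of I \<alpha> \<beta> q] by simp

lemma flat_sums_sum:
  assumes "finite J" "\<And>i. i \<in> J \<Longrightarrow> h i \<in> flat_sums I \<alpha> \<beta>"
  shows "(\<lambda>z. \<Sum>i\<in>J. h i z) \<in> flat_sums I \<alpha> \<beta>"
  using assms by (induction J) (auto intro: flat_sums.zero flat_sums_add)

lemma flat_prod_has_derivative:
  fixes \<beta> :: "'i \<Rightarrow> 'a::euclidean_space"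
  assumes "finite I"
  shows "(flat_prod I \<alpha> \<beta> q has_derivative
    (\<lambda>v. \<Sum>i\<in>I. flat_prod I \<alpha> \<beta> (q(i := smult (\<beta> i \<bullet> v) (flat_deriv (q i)))) z)) (at z)"
proof -
  have *: "((\<lambda>z. flat_fun (q i) (\<alpha> i + \<beta> i \<bullet> z)) has_derivative
      (\<lambda>v. flat_fun (smult (\<beta> i \<bullet> v) (flat_deriv (q i))) (\<alpha> i + \<beta> i \<bullet> z))) (at z)" for i
  proof -
    have "((\<lambda>z. \<alpha> i + \<beta> i \<bullet> z) has_derivative (\<lambda>v. \<beta> i \<bullet> v)) (at z)"
      by (auto intro!: derivative_eq_intros)
    from DERIV_compose_FDERIV[OF flat_fun_has_field_derivative this]
    show ?thesis by (simp add: flat_fun_smult)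
  qed
  have "((\<lambda>z. complex_of_real (\<Prod>i\<in>I. flat_fun (q i) (\<alpha> i + \<beta> i \<bullet> z))) has_derivative
      (\<lambda>v. of_real (\<Sum>i\<in>I. flat_fun (smult (\<beta> i \<bullet> v) (flat_deriv (q i))) (\<alpha> i + \<beta> i \<bullet> z) *
         (\<Prod>j\<in>I - {i}. flat_fun (q j) (\<alpha> j + \<beta> j \<bullet> z))))) (at z)"
    by (intro has_derivative_of_real has_derivative_prod *)
  also have "(\<lambda>v. complex_of_real (\<Sum>i\<in>I. flat_fun (smult (\<beta> i \<bullet> v) (flat_deriv (q i))) (\<alpha> i + \<beta> i \<bullet> z) *
         (\<Prod>j\<in>I - {i}. flat_fun (q j) (\<alpha> j + \<beta> j \<bullet> z)))) =
      (\<lambda>v. \<Sum>i\<in>I. flat_prod I \<alpha> \<beta> (q(i := smult (\<beta> i \<bullet> v) (flat_deriv (q i)))) z)"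
    unfolding of_real_sum flat_prod_def
    by (intro ext sum.cong refl arg_cong[where f = of_real])
       (simp add: prod.remove[OF assms])
  finally show ?thesis by (simp add: flat_prod_def[abs_def])
qed

lemma flat_sums_has_derivative:
  fixes \<beta> :: "'i \<Rightarrow> 'a::euclidean_space"
  assumes "h \<in> flat_sums I \<alpha> \<beta>" "finite I"
  obtains h' where "\<And>z. (h has_derivative (\<lambda>v. h' v z)) (at z)" "\<And>v. h' v \<in> flat_sums I \<alpha> \<beta>"
proof -
  have "\<exists>h'. (\<forall>z. (h has_derivative (\<lambda>v. h' v z)) (at z)) \<and> (\<forall>v. h' v \<in> flat_sums I \<alpha> \<beta>)"
    using assms(1)
  proof induction
    case zero
    show ?case by (rule exI[of _ "\<lambda>v z. 0"]) (auto intro: flat_sums.zero)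
  next
    case (add h q)
    then obtain h' where h': "\<And>z. (h has_derivative (\<lambda>v. h' v z)) (at z)" "\<And>v. h' v \<in> flat_sums I \<alpha> \<beta>"
      by blast
    show ?case
      by (rule exI[of _ "\<lambda>v z. (\<Sum>i\<in>I. flat_prod I \<alpha> \<beta> (q(i := smult (\<beta> i \<bullet> v) (flat_deriv (q i)))) z) + h' v z"])
         (auto intro!: has_derivative_add flat_prod_has_derivative assms h' flat_sums_add
            flat_sums_sum flat_sums_flat_prod)
  qed
  then show thesis using that by blast
qed

lemma flat_sums_eq_0:
  assumes "h \<in> flat_sums I \<alpha> \<beta>" "finite I" "i \<in> I" "\<alpha> i + \<beta> i \<bullet> z \<le> 0"
  shows "h z = 0"
  using assms(1)
proof induction
  case (add h q)
  have "(\<Prod>i\<in>I. flat_fun (q i) (\<alpha> i + \<beta> i \<bullet> z)) = 0"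
    using assms by (intro prod_zero) (auto simp: flat_fun_def intro!: bexI[of _ i])
  then show ?case using add by (simp add: flat_prod_def)
qed simp

lemma dir_derivs_flat_sums:
  fixes \<beta> :: "'i \<Rightarrow> 'a::euclidean_space"
  assumes "h \<in> flat_sums I \<alpha> \<beta>" "finite I"
  shows "dir_derivs vs h \<in> flat_sums I \<alpha> \<beta>"
proof (induction vs)
  case (Cons v vs)
  obtain h' where h': "\<And>z. (dir_derivs vs h has_derivative (\<lambda>v. h' v z)) (at z)"
      "\<And>v. h' v \<in> flat_sums I \<alpha> \<beta>"
    using flat_sums_has_derivative[OF Cons assms(2)] by blast
  have "frechet_derivative (dir_derivs vs h) (at z) = (\<lambda>v. h' v z)" for z
    using frechet_derivative_at[OF h'(1)] by simp
  then show ?case using h'(2) by simp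
qed (use assms in simp)

text \<open>All iterated derivatives stay in \<open>flat_sums\<close>. Its members are continuous and vanish outside the set in the
  last hypothesis, so boundedness of that set gives rapid decay for free.\<close>

lemma flat_sums_schwartz:
  fixes \<beta> :: "'i \<Rightarrow> 'a::euclidean_space"
  assumes h: "h \<in> flat_sums I \<alpha> \<beta>" and I: "finite I"
    and bdd: "bounded {z. \<forall>i\<in>I. 0 < \<alpha> i + \<beta> i \<bullet> z}"
  shows "schwartz h"
  unfolding schwartz_def
proof (intro ballI conjI allI)
  fix vs :: "'a list" and N :: nat
  let ?D = "dir_derivs vs h"
  have D: "?D \<in> flat_sums I \<alpha> \<beta>" by (rule dir_derivs_flat_sums[OF h I])
  then show diff: "?D differentiable at z" for z
    using flat_sums_has_derivative[OF D I] unfolding differentiable_def by metis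
  \<comment> \<open>Continuity bounds the function on a ball; outside the ball it vanishes.\<close>
  obtain r where r: "{z. \<forall>i\<in>I. 0 < \<alpha> i + \<beta> i \<bullet> z} \<subseteq> cball 0 r"
    using bounded_subset_ballD[OF bdd, of 0] ball_subset_cball by blast
  let ?k = "\<lambda>z. (1 + norm z) ^ N *\<^sub>R ?D z"
  have "continuous_on (cball 0 r) ?k"
    by (intro continuous_intros continuous_at_imp_continuous_on ballI differentiable_imp_continuous_within diff)
  then have "bounded (insert 0 (?k ` cball 0 r))"
    by (simp add: compact_continuous_image compact_imp_bounded)
  moreover have "range ?k \<subseteq> insert 0 (?k ` cball 0 r)"
  proof (rule image_subsetI)
    fix z
    show "?k z \<in> insert 0 (?k ` cball 0 r)"
    proof (cases "z \<in> cball 0 r")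
      case False
      with r obtain i where "i \<in> I" "\<alpha> i + \<beta> i \<bullet> z \<le> 0" by force
      with flat_sums_eq_0[OF D I] show ?thesis by simp
    qed blast
  qed
  ultimately show "bounded (range ?k)" by (rule bounded_subset)
qed

text \<open>The parameter \<open>c\<close> steepens the bump: it tends to the indicator of the box as \<open>c\<close> grows.\<close>

definition box_bump :: "real \<Rightarrow> 'a::euclidean_space \<Rightarrow> 'a \<Rightarrow> 'a \<Rightarrow> real" where
  "box_bump c a b z =
     (\<Prod>i\<in>Basis. flat_fun 1 (c * ((z - a) \<bullet> i)) * flat_fun 1 (c * ((b - z) \<bullet> i)))"

lemma box_bump_eq_0:
  assumes "c > 0" "z \<notin> box a b"
  shows "box_bump c a b z = 0"
proof -
  obtain i where i: "i \<in> Basis" "\<not> (a \<bullet> i < z \<bullet> i \<and> z \<bullet> i < b \<bullet> i)"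
    using assms(2) by (auto simp: mem_box)
  have "flat_fun 1 (c * ((z - a) \<bullet> i)) * flat_fun 1 (c * ((b - z) \<bullet> i)) = 0"
    using i(2) assms(1) by (auto simp: flat_fun_def zero_less_mult_iff inner_diff_left)
  then show ?thesis unfolding box_bump_def
    by (intro prod_zero[OF finite_Basis bexI[OF _ i(1)]])
qed

lemma box_bump_pos:
  assumes "c > 0" "z \<in> box a b"
  shows "box_bump c a b z > 0"
  unfolding box_bump_def using assms
  by (intro prod_pos) (auto simp: flat_fun_def mem_box inner_diff_left)

lemma box_bump_bounds: "0 \<le> box_bump c a b z" "box_bump c a b z \<le> 1"
proof -
  have "0 \<le> flat_fun 1 x" "flat_fun 1 x \<le> 1" for x
    by (auto simp: flat_fun_def)
  then show "0 \<le> box_bump c a b z" "box_bump c a b z \<le> 1"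
    unfolding box_bump_def by (auto intro!: prod_nonneg prod_le_1 mult_le_one)
qed

lemma box_bump_schwartz:
  fixes a b :: "'a::euclidean_space"
  assumes c: "c > 0"
  shows "schwartz (\<lambda>z. complex_of_real (box_bump c a b z))"
proof -
  \<comment> \<open>Each coordinate contributes two affine functions, one for the lower and one for the upper face.\<close>
  define \<beta> :: "'a \<times> bool \<Rightarrow> 'a" where "\<beta> = (\<lambda>(i, s). if s then c *\<^sub>R i else - (c *\<^sub>R i))"
  define \<alpha> :: "'a \<times> bool \<Rightarrow> real" where "\<alpha> = (\<lambda>(i, s). if s then - c * (a \<bullet> i) else c * (b \<bullet> i))"
  let ?I = "(Basis :: 'a set) \<times> (UNIV :: bool set)"
  have ab: "\<alpha> (i, True) + \<beta> (i, True) \<bullet> z = c * ((z - a) \<bullet> i)"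
      "\<alpha> (i, False) + \<beta> (i, False) \<bullet> z = c * ((b - z) \<bullet> i)" for i z
    by (simp_all add: \<alpha>_def \<beta>_def inner_diff_left inner_diff_right inner_commute algebra_simps)
  have "(\<lambda>z. complex_of_real (box_bump c a b z)) = flat_prod ?I \<alpha> \<beta> (\<lambda>_. 1)"
  proof
    fix z
    have "(\<Prod>p\<in>?I. flat_fun 1 (\<alpha> p + \<beta> p \<bullet> z)) =
        (\<Prod>i\<in>Basis. \<Prod>s\<in>UNIV. flat_fun 1 (\<alpha> (i, s) + \<beta> (i, s) \<bullet> z))"
      by (simp add: prod.cartesian_product)
    also have "\<dots> = box_bump c a b z"
      unfolding box_bump_def by (simp only: UNIV_bool) (simp add: ab mult.commute)
    finally show "complex_of_real (box_bump c a b z) = flat_prod ?I \<alpha> \<beta> (\<lambda>_. 1) z"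
      by (simp add: flat_prod_def)
  qed
  moreover have "bounded {z. \<forall>i\<in>?I. 0 < \<alpha> i + \<beta> i \<bullet> z}"
  proof (rule bounded_subset[OF bounded_box[of a b]], rule subsetI)
    fix z assume "z \<in> {z. \<forall>i\<in>?I. 0 < \<alpha> i + \<beta> i \<bullet> z}"
    then have pos: "0 < \<alpha> (i, s) + \<beta> (i, s) \<bullet> z" if "i \<in> Basis" for i s
      using that by blast
    have "0 < c * ((z - a) \<bullet> i)" "0 < c * ((b - z) \<bullet> i)" if "i \<in> Basis" for i
      using pos[OF that, of True] pos[OF that, of False] unfolding ab by simp_all
    then show "z \<in> box a b" using c by (simp add: mem_box inner_diff_left zero_less_mult_iff)
  qed
  ultimately show ?thesis
    using flat_sums_schwartz[OF flat_sums_flat_prod, of ?I \<alpha> \<beta> "\<lambda>_. 1"] by simp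
qed

lemma box_bump_tendsto:
  fixes a b :: "'a::euclidean_space"
  shows "(\<lambda>n. box_bump (real (Suc n)) a b z) \<longlonglongrightarrow> indicator (box a b) z"
proof (cases "z \<in> box a b")
  case True
  have *: "(\<lambda>n. flat_fun 1 (real (Suc n) * t)) \<longlonglongrightarrow> 1" if "t > 0" for t
  proof -
    have "(\<lambda>n. exp (- (1 / t * (1 / real (Suc n))))) \<longlonglongrightarrow> exp (- (1 / t * 0))"
      by (intro tendsto_intros LIMSEQ_Suc lim_1_over_n)
    then show ?thesis using that by (simp add: flat_fun_def mult.commute)
  qed
  have "(\<lambda>n. box_bump (real (Suc n)) a b z) \<longlonglongrightarrow> (\<Prod>i\<in>(Basis::'a set). 1 * 1)"
    unfolding box_bump_def using True
    by (intro tendsto_prod tendsto_mult *) (auto simp: mem_box inner_diff_left)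
  then show ?thesis using True by simp
next
  case False
  then show ?thesis by (simp add: box_bump_eq_0 del: of_nat_Suc)
qed

lemma box_bump_support:
  assumes "c > 0"
  shows "fun_support (\<lambda>z. complex_of_real (box_bump c a b z)) \<subseteq> cbox a b"
  unfolding fun_support_def
  by (rule closure_minimal) (use box_bump_eq_0[OF assms] box_subset_cbox in force)+

lemma box_bump_continuous:
  assumes "c > 0"
  shows "continuous_on UNIV (box_bump c a b)"
proof -
  have "(\<lambda>z. complex_of_real (box_bump c a b z)) differentiable at z" for z
    using box_bump_schwartz[OF assms, of a b] unfolding schwartz_def
    by (metis dir_derivs.simps(1) lists.Nil)
  then have "continuous_on UNIV (\<lambda>z. Re (complex_of_real (box_bump c a b z)))"
    by (intro continuous_intros continuous_at_imp_continuous_on ballI differentiable_imp_continuous_within)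
  then show ?thesis by simp
qed


section \<open>The function representing a distribution\<close>

text \<open>Boxes form an intersection-stable generator of the Borel sets, so this is Dynkin's argument.\<close>

lemma set_integral_zero_of_boxes:
  fixes h :: "'a::euclidean_space \<Rightarrow> complex"
  assumes h: "integrable lborel h" and A: "A \<in> sets borel"
    and box: "\<And>a b. (LINT z:box a b|lborel. h z) = 0"
  shows "(LINT z:A|lborel. h z) = 0"
proof -
  have si: "set_integrable lborel B h" if "B \<in> sets borel" for B
    using that h unfolding set_integrable_def by (intro integrable_mult_indicator) auto
  have univ: "(LINT z:UNIV|lborel. h z) = 0"
  proof -
    let ?A = "\<lambda>n::nat. box (- (real n *\<^sub>R One)) (real n *\<^sub>R One) :: 'a set"
    have inc: "incseq ?A"
      by (rule incseq_SucI) (force simp: mem_box)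
    have "(\<lambda>n. LINT z:?A n|lborel. h z) \<longlonglongrightarrow> (LINT z:(\<Union>n. ?A n)|lborel. h z)"
      by (rule set_integral_cont_up[OF _ inc]) (auto intro: si)
    then have "(\<lambda>n::nat. 0) \<longlonglongrightarrow> (LINT z:UNIV|lborel. h z)"
      by (simp only: box UN_box_eq_UNIV)
    then show ?thesis by (simp add: LIMSEQ_const_iff)
  qed
  have "Int_stable (range (\<lambda>(a, b). box a b :: 'a set))"
    by (auto simp: Int_stable_def box_Int_box)
  moreover have "(range (\<lambda>(a, b). box a b :: 'a set)) \<subseteq> Pow UNIV"
    by auto
  moreover have "A \<in> sigma_sets UNIV (range (\<lambda>(a, b). box a b))"
    using A unfolding borel_eq_box by simp
  ultimately show ?thesis
  proof (induction rule: sigma_sets_induct_disjoint)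
    case (basic A)
    then show ?case using box by auto
  next
    case empty
    then show ?case by (simp add: set_lebesgue_integral_def)
  next
    case (compl A)
    then have [measurable]: "A \<in> sets borel"
      by (simp add: borel_eq_box)
    have "(LINT z:(UNIV - A) \<union> A|lborel. h z) = (LINT z:UNIV - A|lborel. h z) + (LINT z:A|lborel. h z)"
      by (rule set_integral_Un) (auto intro: si)
    then show ?case using compl univ by simp
  next
    case (union A)
    then have [measurable]: "A i \<in> sets borel" for i
      by (auto simp: borel_eq_box)
    have "(LINT z:(\<Union>i. A i)|lborel. h z) = (\<Sum>i. LINT z:A i|lborel. h z)"
      using union by (intro lebesgue_integral_countable_add si) (auto simp: disjoint_family_on_def)
    then show ?case using union by simp
  qed
qed

lemma completion_ex_borel_measurable_complex:
  fixes h :: "'a \<Rightarrow> complex"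
  assumes "h \<in> borel_measurable (completion M)"
  obtains h' where "h' \<in> borel_measurable M" "AE z in M. h z = h' z"
proof -
  have "(\<lambda>z. Re (h z)) \<in> borel_measurable (completion M)" "(\<lambda>z. Im (h z)) \<in> borel_measurable (completion M)"
    using assms by (auto intro: borel_measurable_Re borel_measurable_Im measurable_compose)
  from this[THEN completion_ex_borel_measurable_real]
  obtain u v where uv [measurable]: "u \<in> borel_measurable M" "v \<in> borel_measurable M"
      and eq: "AE z in M. Re (h z) = u z" "AE z in M. Im (h z) = v z"
    by blast
  show thesis
  proof (rule that)
    show "(\<lambda>z. Complex (u z) (v z)) \<in> borel_measurable M"
      by (simp add: borel_measurable_complex_iff)
    show "AE z in M. h z = Complex (u z) (v z)"
      using eq by eventually_elim (simp add: complex_eq_iff)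
  qed
qed

text \<open>Passing to a Borel version of \<open>h\<close> brings the sigma-finite measure \<open>lborel\<close> into play, for which
  vanishing of all set integrals implies vanishing almost everywhere.\<close>

lemma AE_zero_of_box_integrals:
  fixes h :: "'a::euclidean_space \<Rightarrow> complex"
  assumes h: "integrable lebesgue h" and box: "\<And>a b. (LINT z:box a b|lebesgue. h z) = 0"
  shows "AE z in lebesgue. h z = 0"
proof -
  obtain h' where h' [measurable]: "h' \<in> borel_measurable lborel" and eq: "AE z in lborel. h z = h' z"
    using completion_ex_borel_measurable_complex[OF borel_measurable_integrable[OF h]] by blast
  have eq': "AE z in lebesgue. h z = h' z" using eq by (rule AE_completion)
  have int: "integrable lebesgue h'"
    by (rule integrable_cong_AE_imp[OF h measurable_completion[OF h'] eq'])
  then have int': "integrable lborel h'" by (simp add: integrable_completion)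
  have "(LINT z:box a b|lborel. h' z) = 0" for a b
  proof -
    have "(LINT z:box a b|lborel. h' z) = (LINT z:box a b|lebesgue. h' z)"
      unfolding set_lebesgue_integral_def by (rule integral_completion[symmetric]) measurable
    also have "\<dots> = (LINT z:box a b|lebesgue. h z)"
    proof (rule set_lebesgue_integral_cong_AE)
      show "AE z \<in> box a b in lebesgue. h' z = h z" using eq' by eventually_elim simp
    qed (use int h in \<open>simp_all add: borel_measurable_integrable\<close>)
    finally show ?thesis by (simp add: box)
  qed
  then have "AE z in lborel. h' z = 0"
    using set_integral_zero_of_boxes[OF int']
    by (intro sigma_finite_measure.density_zero[OF sigma_finite_lborel int']) simp
  with eq have "AE z in lborel. h z = 0" by eventually_elim simp
  then show ?thesis by (rule AE_completion)
qed

text \<open>A bump function on a slightly larger box is bounded below by a positive constant on the compact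
  box, and its product with \<open>H\<close> is integrable.\<close>

lemma integrable_on_box_of_test_functions:
  fixes H :: "'a::euclidean_space \<Rightarrow> complex"
  assumes H: "H \<in> borel_measurable lebesgue"
    and int: "\<And>\<phi>. schwartz \<phi> \<Longrightarrow> integrable lebesgue (\<lambda>z. H z * \<phi> z)"
  shows "integrable lebesgue (\<lambda>z. indicator (cbox a b) z *\<^sub>R H z)"
proof (cases "cbox a b = {}")
  case False
  let ?\<phi> = "box_bump 1 (a - One) (b + One)"
  have sub: "cbox a b \<subseteq> box (a - One) (b + One)"
    by (force simp: mem_box inner_diff_left inner_add_left)
  have "continuous_on (cbox a b) ?\<phi>"
    by (rule continuous_on_subset[OF box_bump_continuous]) auto
  from continuous_attains_inf[OF compact_cbox False this]
  obtain y where y: "y \<in> cbox a b" "\<And>z. z \<in> cbox a b \<Longrightarrow> ?\<phi> y \<le> ?\<phi> z" by blast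
  have pos: "?\<phi> y > 0" using y(1) sub by (intro box_bump_pos) auto
  have "integrable lebesgue (\<lambda>z. H z * complex_of_real (?\<phi> z))"
    by (intro int box_bump_schwartz) simp
  then have "integrable lebesgue (\<lambda>z. (H z * complex_of_real (?\<phi> z)) / of_real (?\<phi> y))"
    by (rule integrable_divide_zero) 
  then show ?thesis
  proof (rule Bochner_Integration.integrable_bound)
    show "(\<lambda>z. indicator (cbox a b) z *\<^sub>R H z) \<in> borel_measurable lebesgue"
      using H by (intro borel_measurable_scaleR borel_measurable_indicator) auto
    show "AE z in lebesgue. norm (indicator (cbox a b) z *\<^sub>R H z)
        \<le> norm ((H z * complex_of_real (?\<phi> z)) / of_real (?\<phi> y))"
    proof (rule AE_I2)
      fix z
      have "norm (H z) * ?\<phi> y \<le> norm (H z) * ?\<phi> z" if "z \<in> cbox a b"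
        using y(2)[OF that] by (intro mult_left_mono) auto
      then show "norm (indicator (cbox a b) z *\<^sub>R H z)
          \<le> norm ((H z * complex_of_real (?\<phi> z)) / of_real (?\<phi> y))"
        using pos box_bump_bounds(1)[of 1 "a - One" "b + One" z]
        by (auto simp: indicator_def norm_divide norm_mult pos_le_divide_eq)
    qed
  qed
qed simp

text \<open>The bumps with steepness \<open>Suc n\<close> turn, by dominated convergence, the hypothesis on test functions
  into the vanishing of the integral over every box inside \<open>U\<close>; countably many boxes cover \<open>U\<close>.\<close>

lemma fundamental_lemma_calculus_of_variations:
  fixes H :: "'a::euclidean_space \<Rightarrow> complex"
  assumes H: "H \<in> borel_measurable lebesgue"
    and int: "\<And>\<phi>. schwartz \<phi> \<Longrightarrow> integrable lebesgue (\<lambda>z. H z * \<phi> z)"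
    and U: "open U"
    and zero: "\<And>\<phi>. schwartz \<phi> \<Longrightarrow> compact (fun_support \<phi>) \<Longrightarrow> fun_support \<phi> \<subseteq> U \<Longrightarrow>
        (\<integral>z. H z * \<phi> z \<partial>lebesgue) = 0"
  shows "AE z in lebesgue. z \<in> U \<longrightarrow> H z = 0"
proof -
  have box0: "(LINT z:box a b|lebesgue. H z) = 0" if ab: "cbox a b \<subseteq> U" for a b
  proof -
    let ?s = "\<lambda>n z. H z * complex_of_real (box_bump (real (Suc n)) a b z)"
    have sch: "schwartz (\<lambda>z. complex_of_real (box_bump (real (Suc n)) a b z))" for n
      by (rule box_bump_schwartz) simp
    have sup: "fun_support (\<lambda>z. complex_of_real (box_bump (real (Suc n)) a b z)) \<subseteq> cbox a b" for n
      by (rule box_bump_support) simp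
    have cpt: "compact (fun_support (\<lambda>z. complex_of_real (box_bump (real (Suc n)) a b z)))" for n
      unfolding compact_eq_bounded_closed
      using bounded_subset[OF bounded_cbox sup] by (simp add: fun_support_def)
    have "(\<lambda>n. \<integral>z. ?s n z \<partial>lebesgue) \<longlonglongrightarrow> (\<integral>z. indicator (box a b) z *\<^sub>R H z \<partial>lebesgue)"
    proof (rule integral_dominated_convergence)
      show "(\<lambda>z. indicator (box a b) z *\<^sub>R H z) \<in> borel_measurable lebesgue"
        using H by (intro borel_measurable_scaleR borel_measurable_indicator) auto
      show "?s n \<in> borel_measurable lebesgue" for n
        by (rule borel_measurable_integrable[OF int[OF sch]])
      show "integrable lebesgue (\<lambda>z. norm (indicator (cbox a b) z *\<^sub>R H z))"
        by (intro integrable_norm integrable_on_box_of_test_functions H int)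
      show "AE z in lebesgue. (\<lambda>n. ?s n z) \<longlonglongrightarrow> indicator (box a b) z *\<^sub>R H z"
      proof (rule AE_I2)
        fix z
        have "(\<lambda>n. ?s n z) \<longlonglongrightarrow> H z * complex_of_real (indicator (box a b) z)"
          by (intro tendsto_mult tendsto_const tendsto_of_real box_bump_tendsto)
        then show "(\<lambda>n. ?s n z) \<longlonglongrightarrow> indicator (box a b) z *\<^sub>R H z"
          by (simp add: scaleR_conv_of_real mult.commute)
      qed
      show "AE z in lebesgue. norm (?s n z) \<le> norm (indicator (cbox a b) z *\<^sub>R H z)" for n
      proof (rule AE_I2)
        fix z
        show "norm (?s n z) \<le> norm (indicator (cbox a b) z *\<^sub>R H z)"
        proof (cases "z \<in> box a b")
          case True
          then have "z \<in> cbox a b" using box_subset_cbox by blast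
          then show ?thesis
            using box_bump_bounds[of "real (Suc n)" a b z] mult_left_mono[of "box_bump (real (Suc n)) a b z" 1 "norm (H z)"]
            by (simp add: norm_mult del: of_nat_Suc)
        next
          case False
          then show ?thesis by (simp add: box_bump_eq_0 del: of_nat_Suc)
        qed
      qed
    qed
    moreover have "(\<integral>z. ?s n z \<partial>lebesgue) = 0" for n
      using zero[OF sch cpt] sup ab by blast
    ultimately show ?thesis by (simp add: set_lebesgue_integral_def LIMSEQ_const_iff)
  qed
  have local: "AE z in lebesgue. z \<in> cbox a b \<longrightarrow> H z = 0" if ab: "cbox a b \<subseteq> U" for a b
  proof -
    let ?h = "\<lambda>z. indicator (cbox a b) z *\<^sub>R H z"
    have null: "AE z in lebesgue. z \<notin> cbox a b - box a b"
      using AE_not_in negligible_frontier_interval[of a b] unfolding negligible_iff_null_sets by blast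
    have "AE z in lebesgue. ?h z = 0"
    proof (rule AE_zero_of_box_integrals)
      show "integrable lebesgue ?h" by (rule integrable_on_box_of_test_functions[OF H int])
      fix c d
      obtain p q where pq: "box c d \<inter> box a b = box p q"
        using box_Int_box[of c d a b] by blast
      \<comment> \<open>\<open>box p q\<close> may be empty while \<open>cbox p q\<close> sticks out of \<open>U\<close>.\<close>
      have "box p q = {} \<or> cbox p q \<subseteq> cbox a b"
        using closure_minimal[of "box p q" "cbox a b"] closure_box[of p q] box_subset_cbox[of a b] pq
        by blast
      then have "0 = (\<integral>z. indicator (box p q) z *\<^sub>R H z \<partial>lebesgue)"
        using box0[of p q] ab by (auto simp: set_lebesgue_integral_def)
      also have "\<dots> = (\<integral>z. indicator (box c d) z *\<^sub>R ?h z \<partial>lebesgue)"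
      proof (rule integral_cong_AE)
        show "AE z in lebesgue. indicator (box p q) z *\<^sub>R H z = indicator (box c d) z *\<^sub>R ?h z"
          using null unfolding pq[symmetric]
          by eventually_elim (use box_subset_cbox[of a b] in \<open>auto simp: indicator_def\<close>)
      qed (intro borel_measurable_scaleR borel_measurable_indicator H; simp)+
      finally show "(LINT z:box c d|lebesgue. ?h z) = 0" by (simp add: set_lebesgue_integral_def)
    qed
    then show ?thesis by eventually_elim (simp add: indicator_def)
  qed
  obtain D where D: "countable D" "D \<subseteq> Pow U" "\<And>X. X \<in> D \<Longrightarrow> \<exists>a b. X = cbox a b" "\<Union>D = U"
    using open_countable_Union_open_cbox[OF U] by blast
  have "AE z in lebesgue. \<forall>X\<in>D. z \<in> X \<longrightarrow> H z = 0"
    unfolding AE_ball_countable[OF D(1)]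
  proof
    fix X assume X: "X \<in> D"
    then obtain a b where "X = cbox a b" using D(3) by blast
    with local[of a b] X D(2) show "AE z in lebesgue. z \<in> X \<longrightarrow> H z = 0" by auto
  qed
  then show ?thesis by eventually_elim (use D(4) in blast)
qed

lemma represents_AE_unique:
  assumes F: "represents F u" and G: "represents G u"
  shows "AE z in lebesgue. F z = G z"
proof -
  have meas: "F \<in> borel_measurable lebesgue" "G \<in> borel_measurable lebesgue"
    using F G by (auto simp: represents_def)
  have int: "integrable lebesgue (\<lambda>z. F z * \<phi> z)" "integrable lebesgue (\<lambda>z. G z * \<phi> z)"
      "(\<integral>z. F z * \<phi> z \<partial>lebesgue) = (\<integral>z. G z * \<phi> z \<partial>lebesgue)" if "schwartz \<phi>" for \<phi>
    using F G that by (auto simp: represents_def)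
  \<comment> \<open>The difference of the two functions annihilates all test functions.\<close>
  have "AE z in lebesgue. z \<in> UNIV \<longrightarrow> F z - G z = 0"
    by (rule fundamental_lemma_calculus_of_variations)
       (use meas int in \<open>auto simp: left_diff_distrib intro: borel_measurable_diff\<close>)
  then show ?thesis by simp
qed

lemma closed_dist_support: "closed (dist_support u)"
proof -
  have "- dist_support u = \<Union>{U. open U \<and> (\<forall>\<phi>. schwartz \<phi> \<and> compact (fun_support \<phi>) \<and> fun_support \<phi> \<subseteq> U \<longrightarrow> u \<phi> = 0)}"
    unfolding dist_support_def by auto
  then show ?thesis by (metis (no_types, lifting) closed_def mem_Collect_eq open_Union)
qed

text \<open>The complement of the support is a union of open sets on which \<open>u\<close> vanishes; by Lindelof's theorem
  countably many of them suffice, so the exceptional null sets can be united.\<close>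

lemma represents_zero_off_dist_support:
  assumes F: "represents F u"
  shows "AE z in lebesgue. z \<notin> dist_support u \<longrightarrow> F z = 0"
proof -
  let ?V = "{U. open U \<and> (\<forall>\<phi>. schwartz \<phi> \<and> compact (fun_support \<phi>) \<and> fun_support \<phi> \<subseteq> U \<longrightarrow> u \<phi> = 0)}"
  have eq: "- dist_support u = \<Union>?V"
    unfolding dist_support_def by auto
  obtain V where V: "V \<subseteq> ?V" "countable V" "\<Union>V = \<Union>?V"
    using Lindelof[of ?V] by blast
  have "AE z in lebesgue. z \<in> U \<longrightarrow> F z = 0" if "U \<in> V" for U
  proof (rule fundamental_lemma_calculus_of_variations)
    show "F \<in> borel_measurable lebesgue" "\<And>\<phi>. schwartz \<phi> \<Longrightarrow> integrable lebesgue (\<lambda>z. F z * \<phi> z)"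
      using F by (auto simp: represents_def)
    show "open U" using that V(1) by blast
    show "(\<integral>z. F z * \<phi> z \<partial>lebesgue) = 0"
      if "schwartz \<phi>" "compact (fun_support \<phi>)" "fun_support \<phi> \<subseteq> U" for \<phi>
    proof -
      have "u \<phi> = 0" using that \<open>U \<in> V\<close> V(1) by blast
      then show ?thesis using F that(1) by (simp add: represents_def)
    qed
  qed
  then have "AE z in lebesgue. \<forall>U\<in>V. z \<in> U \<longrightarrow> F z = 0"
    unfolding AE_ball_countable[OF V(2)] by blast
  then show ?thesis by eventually_elim (use eq V(3) in blast)
qed


section \<open>Convolution with a Schwartz function\<close>

lemma dir_derivs_reflect:
  fixes g :: "'a::euclidean_space \<Rightarrow> complex"
  assumes g: "schwartz g" and vs: "vs \<in> lists Basis"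
  shows "dir_derivs vs (\<lambda>w. g (z - w)) w = (- 1) ^ length vs * dir_derivs vs g (z - w)"
  using vs
proof (induction vs arbitrary: w)
  case (Cons v vs)
  have vs: "vs \<in> lists Basis" using Cons by auto
  let ?D = "dir_derivs vs g"
  have eq: "dir_derivs vs (\<lambda>w. g (z - w)) = (\<lambda>w. (- 1) ^ length vs * ?D (z - w))"
    using Cons.IH by blast
  have "?D differentiable at (z - w)" using g vs by (simp add: schwartz_def)
  then have d: "(?D has_derivative frechet_derivative ?D (at (z - w))) (at (z - w))"
    by (simp add: frechet_derivative_works)
  have "((\<lambda>w. z - w) has_derivative (\<lambda>h. - h)) (at w)"
    by (auto intro!: derivative_eq_intros)
  from has_derivative_compose[OF this d]
  have "((\<lambda>w. (- 1) ^ length vs * ?D (z - w)) has_derivative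
      (\<lambda>h. (- 1) ^ length vs * frechet_derivative ?D (at (z - w)) (- h))) (at w)"
    by (rule has_derivative_mult_right)
  from frechet_derivative_at[OF this, symmetric] linear_neg[OF has_derivative_linear[OF d], of v]
  show ?case by (simp add: eq)
qed simp

text \<open>Needed because \<open>dist_conv f g z\<close> evaluates \<open>f\<close> at this reflected translate, and \<open>represents\<close> speaks of
  Schwartz functions only. The weights are compared through the triangle inequality
  \<open>1 + \<bar>w\<bar> \<le> (1 + \<bar>z\<bar>) * (1 + \<bar>z - w\<bar>)\<close>.\<close>

lemma schwartz_reflect:
  fixes g :: "'a::euclidean_space \<Rightarrow> complex"
  assumes g: "schwartz g"
  shows "schwartz (\<lambda>w. g (z - w))"
  unfolding schwartz_def
proof (intro ballI conjI allI)
  fix vs :: "'a list" and N :: nat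
  assume vs: "vs \<in> lists Basis"
  let ?D = "dir_derivs vs g"
  have eq: "dir_derivs vs (\<lambda>w. g (z - w)) = (\<lambda>w. (- 1) ^ length vs * ?D (z - w))"
    using dir_derivs_reflect[OF g vs] by blast
  show "dir_derivs vs (\<lambda>w. g (z - w)) differentiable at w" for w
  proof -
    have "?D differentiable at (z - w)" using g vs by (simp add: schwartz_def)
    then have "(\<lambda>w. ?D (z - w)) differentiable at w"
      by (intro differentiable_compose[of ?D "\<lambda>w. z - w"]) simp_all
    then show ?thesis unfolding eq by (intro differentiable_mult) simp_all
  qed
  obtain B where B: "\<And>y. norm ((1 + norm y) ^ N *\<^sub>R ?D y) \<le> B"
    using g vs unfolding schwartz_def bounded_iff by blast
  show "bounded (range (\<lambda>w. (1 + norm w) ^ N *\<^sub>R dir_derivs vs (\<lambda>w. g (z - w)) w))"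
    unfolding bounded_iff
  proof (intro exI[of _ "(1 + norm z) ^ N * B"] ballI, clarify)
    fix w
    have "norm w \<le> norm z + norm (z - w)" using norm_triangle_ineq4[of z "z - w"] by simp
    also have "1 + (norm z + norm (z - w)) \<le> (1 + norm z) * (1 + norm (z - w))"
      by (simp add: algebra_simps)
    finally have "1 + norm w \<le> (1 + norm z) * (1 + norm (z - w))" by simp
    then have "(1 + norm w) ^ N \<le> (1 + norm z) ^ N * (1 + norm (z - w)) ^ N"
      by (metis add_nonneg_nonneg norm_ge_zero power_mono power_mult_distrib zero_le_one)
    then have "norm ((1 + norm w) ^ N *\<^sub>R dir_derivs vs (\<lambda>w. g (z - w)) w)
        \<le> (1 + norm z) ^ N * (1 + norm (z - w)) ^ N * norm (?D (z - w))"
      unfolding eq by (simp add: norm_mult norm_power mult_right_mono)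
    also have "\<dots> = (1 + norm z) ^ N * norm ((1 + norm (z - w)) ^ N *\<^sub>R ?D (z - w))"
      by simp
    also have "\<dots> \<le> (1 + norm z) ^ N * B"
      by (intro mult_left_mono B) simp
    finally show "norm ((1 + norm w) ^ N *\<^sub>R dir_derivs vs (\<lambda>w. g (z - w)) w) \<le> (1 + norm z) ^ N * B" .
  qed
qed

lemma schwartz_borel_measurable:
  fixes g :: "'a::euclidean_space \<Rightarrow> complex"
  assumes "schwartz g"
  shows "g \<in> borel_measurable borel"
proof -
  have "g differentiable at z" for z
    using assms unfolding schwartz_def by (metis dir_derivs.simps(1) lists.Nil)
  then show ?thesis
    by (intro borel_measurable_continuous_onI continuous_at_imp_continuous_on ballI differentiable_imp_continuous_within)
qed

lemma norm_dist_conv_le: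
  fixes g :: "'a::euclidean_space \<Rightarrow> complex"
  assumes F: "represents F f" and g: "schwartz g" and eq: "AE w in lborel. ennreal (cmod (F w)) = a w"
  shows "ennreal (cmod (dist_conv f g z)) \<le> (\<integral>\<^sup>+w. a w * ennreal (cmod (g (z - w))) \<partial>lborel)"
proof -
  have int: "integrable lebesgue (\<lambda>w. F w * g (z - w))"
      and val: "f (\<lambda>w. g (z - w)) = (\<integral>w. F w * g (z - w) \<partial>lebesgue)"
    using F schwartz_reflect[OF g, of z] by (auto simp: represents_def)
  have "ennreal (cmod (dist_conv f g z)) \<le> (\<integral>\<^sup>+w. ennreal (cmod (F w * g (z - w))) \<partial>lebesgue)"
    unfolding dist_conv_def val by (rule integral_norm_bound_ennreal[OF int])
  also have "\<dots> = (\<integral>\<^sup>+w. ennreal (cmod (F w * g (z - w))) \<partial>lborel)"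
    by (rule nn_integral_completion)
  also have "\<dots> = (\<integral>\<^sup>+w. a w * ennreal (cmod (g (z - w))) \<partial>lborel)"
    using eq by (intro nn_integral_cong_AE, eventually_elim) (simp add: norm_mult ennreal_mult)
  finally show ?thesis .
qed


section \<open>Convolution estimates from measures of overlaps\<close>

lemma enn_sqrt_power2 [simp]: "(enn_sqrt x)\<^sup>2 = x"
  by (cases x) (auto simp: enn_sqrt_def power2_eq_square ennreal_mult[symmetric] ennreal_top_mult ennreal_mult_top)

lemma enn_sqrt_square [simp]: "enn_sqrt (x\<^sup>2) = x"
  by (cases x) (auto simp: enn_sqrt_def power2_eq_square ennreal_mult[symmetric] ennreal_top_mult ennreal_mult_top)

lemma enn_sqrt_mono: "x \<le> y \<Longrightarrow> enn_sqrt x \<le> enn_sqrt y"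
  by (cases x; cases y) (auto simp: enn_sqrt_def top_unique)

lemma enn_sqrt_mult: "enn_sqrt (x * y) = enn_sqrt x * enn_sqrt y"
proof -
  have "enn_sqrt (x * y) = enn_sqrt ((enn_sqrt x * enn_sqrt y)\<^sup>2)"
    by (simp only: power_mult_distrib enn_sqrt_power2)
  then show ?thesis by (simp only: enn_sqrt_square)
qed

lemma enn_sqrt_ennreal: "r \<ge> 0 \<Longrightarrow> enn_sqrt (ennreal r) = ennreal (sqrt r)"
  by (simp add: enn_sqrt_def)

lemma Cauchy_Schwarz_suminf_ennreal:
  fixes x y :: "nat \<Rightarrow> ennreal"
  shows "(\<Sum>l. x l * y l)\<^sup>2 \<le> (\<Sum>l. (x l)\<^sup>2) * (\<Sum>l. (y l)\<^sup>2)"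
  using Cauchy_Schwarz_nn_integral[of x "count_space UNIV" y]
  by (simp add: nn_integral_count_space_nat)

lemma nn_integral_lborel_translate:
  fixes h :: "'a::euclidean_space \<Rightarrow> ennreal"
  assumes [measurable]: "h \<in> borel_measurable borel"
  shows "(\<integral>\<^sup>+z. h (z - w) \<partial>lborel) = (\<integral>\<^sup>+v. h v \<partial>lborel)"
proof -
  have "(\<integral>\<^sup>+v. h v \<partial>lborel) = (\<integral>\<^sup>+v. h v \<partial>distr lborel borel ((+) (- w)))"
    by (simp only: lborel_distr_plus)
  also have "\<dots> = (\<integral>\<^sup>+z. h (- w + z) \<partial>lborel)"
    by (rule nn_integral_distr) auto
  finally show ?thesis by simp
qed

text \<open>Tonelli's theorem together with the substitution \<open>v = z - w\<close> for fixed \<open>w\<close>.\<close>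

lemma nn_integral_overlap:
  fixes G :: "'a::euclidean_space \<Rightarrow> ennreal"
  assumes [measurable]: "G \<in> borel_measurable borel" "S \<in> sets borel" "D \<in> sets borel"
  shows "(\<integral>\<^sup>+z\<in>D. (\<integral>\<^sup>+w\<in>S. G (z - w) \<partial>lborel) \<partial>lborel) =
    (\<integral>\<^sup>+v. G v * emeasure lborel {w \<in> S. w + v \<in> D} \<partial>lborel)"
proof -
  have "(\<integral>\<^sup>+z\<in>D. (\<integral>\<^sup>+w\<in>S. G (z - w) \<partial>lborel) \<partial>lborel) =
      (\<integral>\<^sup>+z. \<integral>\<^sup>+w. G (z - w) * indicator S w * indicator D z \<partial>lborel \<partial>lborel)"
    by (intro nn_integral_cong nn_integral_multc[symmetric]) measurable
  also have "\<dots> = (\<integral>\<^sup>+w. \<integral>\<^sup>+z. G (z - w) * indicator S w * indicator D z \<partial>lborel \<partial>lborel)"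
    by (rule lborel_pair.Fubini') measurable
  also have "\<dots> = (\<integral>\<^sup>+w. \<integral>\<^sup>+v. G v * indicator S w * indicator D (w + v) \<partial>lborel \<partial>lborel)"
  proof (rule nn_integral_cong)
    fix w
    have "(\<lambda>v. G v * indicator S w * indicator D (w + v)) \<in> borel_measurable borel" by measurable
    from nn_integral_lborel_translate[OF this, of w]
    show "(\<integral>\<^sup>+z. G (z - w) * indicator S w * indicator D z \<partial>lborel) =
        (\<integral>\<^sup>+v. G v * indicator S w * indicator D (w + v) \<partial>lborel)" by simp
  qed
  also have "\<dots> = (\<integral>\<^sup>+v. \<integral>\<^sup>+w. G v * indicator S w * indicator D (w + v) \<partial>lborel \<partial>lborel)"
    by (rule lborel_pair.Fubini') measurable
  also have "\<dots> = (\<integral>\<^sup>+v. \<integral>\<^sup>+w. G v * indicator {w \<in> S. w + v \<in> D} w \<partial>lborel \<partial>lborel)"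
    by (intro nn_integral_cong) (simp add: indicator_def)
  also have "\<dots> = (\<integral>\<^sup>+v. G v * emeasure lborel {w \<in> S. w + v \<in> D} \<partial>lborel)"
    by (intro nn_integral_cong nn_integral_cmult_indicator) measurable
  finally show ?thesis .
qed

text \<open>Let \<open>\<alpha> l\<close> be the integral of \<open>a\<^sup>2\<close> over \<open>S l\<close>. The part of the convolution that comes from \<open>S l\<close> has a square of at
  most \<open>\<alpha> l * \<beta> l z\<close>, where the integral of \<open>\<beta> l\<close> over \<open>D\<close> is the integral of \<open>G\<^sup>2\<close> against the
  overlap measure. The Cauchy-Schwarz inequality over \<open>l\<close> with the weights \<open>sqrt (\<sigma> l * \<alpha> l)\<close>
  produces one factor \<open>\<Sum>l. sqrt (\<sigma> l * \<alpha> l)\<close> directly and a second one after integration over \<open>D\<close>. All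
  quantities may be infinite.\<close>

lemma convolution_bound_dyadic:
  fixes a G W :: "'a::euclidean_space \<Rightarrow> ennreal" and S :: "nat \<Rightarrow> 'a set" and \<sigma> :: "nat \<Rightarrow> real"
  assumes [measurable]: "a \<in> borel_measurable borel" "G \<in> borel_measurable borel"
      "\<And>l. S l \<in> sets borel" "D \<in> sets borel" "W \<in> borel_measurable borel"
    and supp: "AE w in lborel. a w = (\<Sum>l. a w * indicator (S l) w)"
    and \<sigma>: "\<And>l. \<sigma> l > 0"
    and overlap: "\<And>l. AE v in lborel. emeasure lborel {w \<in> S l. w + v \<in> D} \<le> ennreal (\<sigma> l) * W v"
  shows "(\<integral>\<^sup>+z\<in>D. (\<integral>\<^sup>+w. a w * G (z - w) \<partial>lborel)\<^sup>2 \<partial>lborel) \<le>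
    (\<Sum>l. enn_sqrt (ennreal (\<sigma> l) * (\<integral>\<^sup>+w\<in>S l. (a w)\<^sup>2 \<partial>lborel)))\<^sup>2 * (\<integral>\<^sup>+v. (G v)\<^sup>2 * W v \<partial>lborel)"
proof -
  define \<alpha> where "\<alpha> l = (\<integral>\<^sup>+w\<in>S l. (a w)\<^sup>2 \<partial>lborel)" for l
  define \<beta> where "\<beta> l z = (\<integral>\<^sup>+w\<in>S l. (G (z - w))\<^sup>2 \<partial>lborel)" for l z
  define X where "X = (\<Sum>l. enn_sqrt (ennreal (\<sigma> l) * \<alpha> l))"
  define N where "N = (\<integral>\<^sup>+v. (G v)\<^sup>2 * W v \<partial>lborel)"
  \<comment> \<open>\<open>\<rho> l\<close> is \<open>sqrt (\<alpha> l / \<sigma> l)\<close>, in a form without division of possibly infinite numbers.\<close>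
  define \<rho> where "\<rho> l = ennreal (1 / \<sigma> l) * enn_sqrt (ennreal (\<sigma> l) * \<alpha> l)" for l
  have inv: "ennreal (\<sigma> l) * ennreal (1 / \<sigma> l) = 1" for l
    using \<sigma>[of l] by (simp add: ennreal_mult[symmetric])
  have [measurable]: "\<beta> l \<in> borel_measurable borel" for l
    unfolding \<beta>_def by measurable
  have pointwise: "(\<integral>\<^sup>+w. a w * G (z - w) \<partial>lborel)\<^sup>2 \<le> X * (\<Sum>l. \<rho> l * \<beta> l z)" for z
  proof -
    define c where "c l = (\<integral>\<^sup>+w. (a w * indicator (S l) w) * (G (z - w) * indicator (S l) w) \<partial>lborel)" for l
    have "(\<integral>\<^sup>+w. a w * G (z - w) \<partial>lborel) = (\<integral>\<^sup>+w. (\<Sum>l. (a w * indicator (S l) w) * (G (z - w) * indicator (S l) w)) \<partial>lborel)"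
      using supp
    proof (intro nn_integral_cong_AE, eventually_elim)
      case (elim w)
      have "a w * G (z - w) = (\<Sum>l. (a w * indicator (S l) w) * G (z - w))"
        by (subst elim) (simp add: ennreal_suminf_multc)
      also have "(\<lambda>l. (a w * indicator (S l) w) * G (z - w)) =
          (\<lambda>l. (a w * indicator (S l) w) * (G (z - w) * indicator (S l) w))"
        by (auto simp: indicator_def)
      finally show ?case .
    qed
    also have "\<dots> = (\<Sum>l. c l)"
      unfolding c_def by (rule nn_integral_suminf) measurable
    finally have eq: "(\<integral>\<^sup>+w. a w * G (z - w) \<partial>lborel) = (\<Sum>l. c l)" .
    have c: "c l \<le> enn_sqrt (enn_sqrt (ennreal (\<sigma> l) * \<alpha> l)) * enn_sqrt (\<rho> l * \<beta> l z)" for l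
    proof -
      have ind: "(x * indicator (S l) w)\<^sup>2 = x\<^sup>2 * indicator (S l) w" for x :: ennreal and w
        by (auto simp: indicator_def)
      have "(c l)\<^sup>2 \<le> (\<integral>\<^sup>+w. (a w * indicator (S l) w)\<^sup>2 \<partial>lborel) *
          (\<integral>\<^sup>+w. (G (z - w) * indicator (S l) w)\<^sup>2 \<partial>lborel)"
        unfolding c_def by (rule Cauchy_Schwarz_nn_integral) measurable
      then have "(c l)\<^sup>2 \<le> \<alpha> l * \<beta> l z"
        by (simp only: ind \<alpha>_def \<beta>_def)
      also have "\<dots> = (ennreal (\<sigma> l) * ennreal (1 / \<sigma> l)) * (\<alpha> l * \<beta> l z)"
        by (simp add: inv)
      also have "\<dots> = ennreal (1 / \<sigma> l) * (enn_sqrt (ennreal (\<sigma> l) * \<alpha> l))\<^sup>2 * \<beta> l z"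
        by (simp only: enn_sqrt_power2) (simp add: mult_ac)
      also have "\<dots> = enn_sqrt (ennreal (\<sigma> l) * \<alpha> l) * (\<rho> l * \<beta> l z)"
        by (simp only: \<rho>_def power2_eq_square mult_ac)
      finally show ?thesis
        using enn_sqrt_mono enn_sqrt_square by (metis enn_sqrt_mult)
    qed
    have "(\<Sum>l. c l)\<^sup>2 \<le> (\<Sum>l. enn_sqrt (enn_sqrt (ennreal (\<sigma> l) * \<alpha> l)) * enn_sqrt (\<rho> l * \<beta> l z))\<^sup>2"
      by (intro power_mono suminf_le c) auto
    also have "\<dots> \<le> X * (\<Sum>l. \<rho> l * \<beta> l z)"
      using Cauchy_Schwarz_suminf_ennreal[of "\<lambda>l. enn_sqrt (enn_sqrt (ennreal (\<sigma> l) * \<alpha> l))" "\<lambda>l. enn_sqrt (\<rho> l * \<beta> l z)"]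
      by (simp add: X_def)
    finally show ?thesis by (simp only: eq)
  qed
  have int: "(\<integral>\<^sup>+z\<in>D. \<beta> l z \<partial>lborel) \<le> ennreal (\<sigma> l) * N" for l
  proof -
    have "(\<integral>\<^sup>+z\<in>D. \<beta> l z \<partial>lborel) = (\<integral>\<^sup>+v. (G v)\<^sup>2 * emeasure lborel {w \<in> S l. w + v \<in> D} \<partial>lborel)"
      unfolding \<beta>_def by (rule nn_integral_overlap) measurable
    also have "\<dots> \<le> (\<integral>\<^sup>+v. (G v)\<^sup>2 * (ennreal (\<sigma> l) * W v) \<partial>lborel)"
      using overlap[of l] by (intro nn_integral_mono_AE, eventually_elim) (rule mult_left_mono, auto)
    also have "\<dots> = (\<integral>\<^sup>+v. ennreal (\<sigma> l) * ((G v)\<^sup>2 * W v) \<partial>lborel)"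
      by (simp add: mult_ac)
    also have "\<dots> = ennreal (\<sigma> l) * N"
      unfolding N_def by (rule nn_integral_cmult) measurable
    finally show ?thesis .
  qed
  have "(\<integral>\<^sup>+z\<in>D. (\<integral>\<^sup>+w. a w * G (z - w) \<partial>lborel)\<^sup>2 \<partial>lborel) \<le>
      (\<integral>\<^sup>+z. X * (\<Sum>l. \<rho> l * (\<beta> l z * indicator D z)) \<partial>lborel)"
    using pointwise by (intro nn_integral_mono) (auto simp: indicator_def)
  also have "\<dots> = X * (\<integral>\<^sup>+z. (\<Sum>l. \<rho> l * (\<beta> l z * indicator D z)) \<partial>lborel)"
    by (rule nn_integral_cmult) measurable
  also have "(\<integral>\<^sup>+z. (\<Sum>l. \<rho> l * (\<beta> l z * indicator D z)) \<partial>lborel) = (\<Sum>l. \<integral>\<^sup>+z. \<rho> l * (\<beta> l z * indicator D z) \<partial>lborel)"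
    by (rule nn_integral_suminf) measurable
  also have "\<dots> = (\<Sum>l. \<rho> l * (\<integral>\<^sup>+z\<in>D. \<beta> l z \<partial>lborel))"
    by (intro suminf_cong nn_integral_cmult) measurable
  also have "X * \<dots> \<le> X * (\<Sum>l. \<rho> l * (ennreal (\<sigma> l) * N))"
    by (intro mult_left_mono suminf_le int) auto
  also have "(\<lambda>l. \<rho> l * (ennreal (\<sigma> l) * N)) = (\<lambda>l. enn_sqrt (ennreal (\<sigma> l) * \<alpha> l) * N)"
  proof
    fix l
    have "\<rho> l * (ennreal (\<sigma> l) * N) = (ennreal (\<sigma> l) * ennreal (1 / \<sigma> l)) * (enn_sqrt (ennreal (\<sigma> l) * \<alpha> l) * N)"
      by (simp only: \<rho>_def mult_ac)
    then show "\<rho> l * (ennreal (\<sigma> l) * N) = enn_sqrt (ennreal (\<sigma> l) * \<alpha> l) * N" by (simp add: inv)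
  qed
  also have "X * (\<Sum>l. enn_sqrt (ennreal (\<sigma> l) * \<alpha> l) * N) = X\<^sup>2 * N"
    by (simp add: ennreal_suminf_multc X_def power2_eq_square mult_ac)
  finally show ?thesis by (simp add: X_def N_def \<alpha>_def)
qed


section \<open>Sublevel sets of the phase difference\<close>

definition phase :: "real \<Rightarrow> real" where "phase x = x ^ 3 - 1 / x"

definition phase_gap :: "real \<Rightarrow> real \<Rightarrow> real" where "phase_gap v x = phase (x + v) - phase x"

text \<open>The phase difference is \<open>v ^ 3 + v * (3 * p + 1 / p)\<close> as a function of \<open>p = x * (x + v)\<close>, and the
  difference of two values of \<open>p\<close> is \<open>(x - y) * (x + y + v)\<close>.\<close>

lemma phase_gap_diff:
  fixes x y v :: real
  assumes nz: "x \<noteq> 0" "x + v \<noteq> 0" "y \<noteq> 0" "y + v \<noteq> 0"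
  shows "phase_gap v x - phase_gap v y =
    v * ((x - y) * (x + y + v)) * (3 - 1 / ((x * (x + v)) * (y * (y + v))))"
proof -
  have gap: "phase_gap v t = v ^ 3 + v * (3 * (t * (t + v)) + 1 / (t * (t + v)))"
    if "t \<noteq> 0" "t + v \<noteq> 0" for t
    using that unfolding phase_gap_def phase_def
    by (simp add: divide_simps) (simp add: algebra_simps power2_eq_square power3_eq_cube)
  define p r where "p = x * (x + v)" and "r = y * (y + v)"
  have pr: "p \<noteq> 0" "r \<noteq> 0" using nz by (simp_all add: p_def r_def)
  have pr': "(x - y) * (x + y + v) = p - r" by (simp add: p_def r_def algebra_simps)
  have "phase_gap v x - phase_gap v y = v * ((3 * p + 1 / p) - (3 * r + 1 / r))"
    unfolding gap[OF nz(1,2)] gap[OF nz(3,4)] p_def r_def by (simp add: algebra_simps)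
  also have "(3 * p + 1 / p) - (3 * r + 1 / r) = (p - r) * (3 - 1 / (p * r))"
    using pr by (simp add: field_simps)
  finally show ?thesis by (simp add: pr' p_def r_def)
qed

text \<open>On one side of the vertex \<open>- v / 2\<close> of the parabola \<open>x * (x + v)\<close>, the distance of two points is
  dominated by the sum of their distances to the vertex.\<close>

lemma abs_diff_le_abs_sum_same_sign:
  fixes x y v :: real
  assumes "0 \<le> (2 * x + v) * (2 * y + v)"
  shows "\<bar>x - y\<bar> \<le> \<bar>x + y + v\<bar>" "\<bar>x + y + v\<bar> = (\<bar>2 * x + v\<bar> + \<bar>2 * y + v\<bar>) / 2"
  using assms by (auto simp: zero_le_mult_iff)

text \<open>In the application \<open>p\<close> and \<open>r\<close> are the products at two points with distance \<open>d\<close>, and \<open>s\<close> is the factor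
  \<open>\<bar>x + y + v\<bar>\<close>. If one of \<open>\<bar>p\<bar>, \<bar>r\<bar>\<close> is away from the critical value \<open>1 / sqrt 3\<close>, the last factor is
  bounded below and \<open>s \<ge> d\<close> suffices. If both are close to it, on the same side, the last factor is
  only comparable to \<open>\<bar>p - r\<bar> = d * s\<close>, and the bound \<open>s \<ge> 1\<close> saves the estimate. If \<open>p\<close> and \<open>r\<close> have
  opposite signs, the last factor exceeds 3.\<close>

lemma critical_factor:
  fixes p r :: real
  assumes nz: "p \<noteq> 0" "r \<noteq> 0"
    and side: "(3 * p\<^sup>2 \<le> 1 \<and> 3 * r\<^sup>2 \<le> 1) \<or> (3 * p\<^sup>2 \<ge> 1 \<and> 3 * r\<^sup>2 \<ge> 1)"
    and S: "1/2 \<le> \<bar>p\<bar> \<Longrightarrow> \<bar>p\<bar> \<le> 2/3 \<Longrightarrow> 1/2 \<le> \<bar>r\<bar> \<Longrightarrow> \<bar>r\<bar> \<le> 2/3 \<Longrightarrow> 1 \<le> s"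
    and s: "s \<ge> 0" "d \<ge> 0" "d \<le> s" "\<bar>p - r\<bar> = d * s"
  shows "d / 10 \<le> s * \<bar>3 - 1 / (p * r)\<bar>"
proof -
  have sd: "d \<le> s * k" if "k \<ge> 1" for k
    using mult_mono[of s s 1 k] s that by simp
  \<comment> \<open>The thresholds 1/2, 56/100, 3/5, 2/3 below are rational points near the critical value \<open>1 / sqrt 3 = 0.577...\<close>.\<close>
  have main: "d / 10 \<le> s * \<bar>3 - 1 / (P * R)\<bar>"
    if PR: "0 < P" "0 < R" "P \<le> R"
      and side: "(3 * P\<^sup>2 \<le> 1 \<and> 3 * R\<^sup>2 \<le> 1) \<or> (3 * P\<^sup>2 \<ge> 1 \<and> 3 * R\<^sup>2 \<ge> 1)"
      and S: "1/2 \<le> P \<Longrightarrow> R \<le> 2/3 \<Longrightarrow> 1 \<le> s"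
      and ds: "R - P = d * s" for P R
  proof -
    have RR: "P * R \<le> R * R" using PR by (auto intro: mult_mono)
    have far: "d / 10 \<le> s * \<bar>3 - 1 / (P * R)\<bar>" if "\<bar>3 - 1 / (P * R)\<bar> \<ge> 1/10"
      using mult_mono[of s s "1/10" "\<bar>3 - 1 / (P * R)\<bar>"] s that by simp
    \<comment> \<open>Near the critical value the factor is only comparable to \<open>R - P = d * s\<close>; the bound \<open>s \<ge> 1\<close> enters twice.\<close>
    have near: "d / 10 \<le> s * \<bar>3 - 1 / (P * R)\<bar>" if "s \<ge> 1" "\<bar>3 - 1 / (P * R)\<bar> \<ge> (R - P) / 10"
    proof -
      have "s * s \<ge> 1" using that(1) mult_mono[of 1 s 1 s] by simp
      then have "d / 10 \<le> s * s * d / 10" using s mult_right_mono[of 1 "s * s" d] by simp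
      also have "\<dots> = s * ((R - P) / 10)" by (simp add: ds)
      also have "\<dots> \<le> s * \<bar>3 - 1 / (P * R)\<bar>" using that s by (intro mult_left_mono)
      finally show ?thesis .
    qed
    have e: "\<bar>3 - 1 / (P * R)\<bar> = \<bar>3 * (P * R) - 1\<bar> / (P * R)"
      using PR by (simp add: abs_if field_simps)
    from side show ?thesis
    proof
      assume lo: "3 * P\<^sup>2 \<le> 1 \<and> 3 * R\<^sup>2 \<le> 1"
      show ?thesis
      proof (cases "P \<ge> 1/2")
        case True
        have R1: "R \<le> 2/3" by (rule power2_le_imp_le) (use lo in \<open>simp_all add: power2_eq_square\<close>)
        have "1 - 3 * (P * R) \<ge> 3 * (R * R) - 3 * (P * R)" using lo by (simp add: power2_eq_square)
        also have "3 * (R * R) - 3 * (P * R) = 3 * R * (R - P)" by (simp add: algebra_simps)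
        finally have "1 - 3 * (P * R) \<ge> 3 * R * (R - P)" .
        moreover have "3 * R * (R - P) \<ge> 1 * (R - P)" using True PR by (intro mult_right_mono) auto
        ultimately have "R - P \<le> 1 - 3 * (P * R)" by (metis mult_1 order_trans)
        then have A: "\<bar>3 * (P * R) - 1\<bar> \<ge> R - P" by linarith
        have "P * R \<le> 1" using lo RR by (simp add: power2_eq_square)
        then have "(R - P) * (P * R) \<le> (R - P) * 1"
          using \<open>P * R \<le> 1\<close> PR by (intro mult_left_mono) auto
        with A have "\<bar>3 - 1 / (P * R)\<bar> \<ge> R - P" unfolding e
          using PR by (simp add: pos_le_divide_eq)
        then show ?thesis using near S True PR R1 by auto
      next
        case False
        have "R \<le> 3/5" by (rule power2_le_imp_le) (use lo in \<open>simp_all add: power2_eq_square\<close>)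
        then have "P * R \<le> 1/2 * (3/5)" using False PR by (intro mult_mono) auto
        then have "\<bar>3 - 1 / (P * R)\<bar> \<ge> 1/10" unfolding e using PR by (simp add: field_simps abs_if)
        then show ?thesis by (rule far)
      qed
    next
      assume hi: "3 * P\<^sup>2 \<ge> 1 \<and> 3 * R\<^sup>2 \<ge> 1"
      have P1: "P \<ge> 1/2" by (rule power2_le_imp_le) (use hi PR in \<open>simp_all add: power2_eq_square\<close>)
      show ?thesis
      proof (cases "R \<le> 2/3")
        case True
        have "3 * (P * R) - 1 \<ge> 3 * (P * R) - 3 * (P * P)" using hi by (simp add: power2_eq_square)
        also have "3 * (P * R) - 3 * (P * P) = 3 * P * (R - P)" by (simp add: algebra_simps)
        finally have "3 * (P * R) - 1 \<ge> 3 * P * (R - P)" .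
        moreover have "3 * P * (R - P) \<ge> 1 * (R - P)" using P1 PR by (intro mult_right_mono) auto
        ultimately have "R - P \<le> 3 * (P * R) - 1" by (metis mult_1 order_trans)
        then have A: "\<bar>3 * (P * R) - 1\<bar> \<ge> R - P" by linarith
        have "P * R \<le> 2/3 * (2/3)" using True PR by (intro mult_mono) auto
        then have "(R - P) * (P * R) \<le> (R - P) * 1" using PR by (intro mult_left_mono) auto
        with A have "\<bar>3 - 1 / (P * R)\<bar> \<ge> R - P" unfolding e
          using PR by (simp add: pos_le_divide_eq)
        then show ?thesis using near S True PR P1 by auto
      next
        case False
        have "P \<ge> 56/100"
        proof (rule ccontr)
          assume "\<not> ?thesis"
          then have "P * P \<le> 56/100 * (56/100)" using PR by (intro mult_mono) auto
          then show False using hi by (simp add: power2_eq_square)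
        qed
        then have "P * R \<ge> 56/100 * (2/3)" using False PR by (intro mult_mono) auto
        then have "\<bar>3 - 1 / (P * R)\<bar> \<ge> 1/10" unfolding e using PR by (simp add: field_simps abs_if)
        then show ?thesis by (rule far)
      qed
    qed
  qed
  have abs_main: "d / 10 \<le> s * \<bar>3 - 1 / (\<bar>p\<bar> * \<bar>r\<bar>)\<bar>" if "\<bar>\<bar>p\<bar> - \<bar>r\<bar>\<bar> = d * s"
  proof (cases "\<bar>p\<bar> \<le> \<bar>r\<bar>")
    case True
    show ?thesis by (rule main) (use nz side S that True in auto)
  next
    case False
    have "d / 10 \<le> s * \<bar>3 - 1 / (\<bar>r\<bar> * \<bar>p\<bar>)\<bar>" by (rule main) (use nz side S that False in auto)
    then show ?thesis by (simp add: mult.commute)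
  qed
  show ?thesis
  proof (cases "p * r > 0")
    case True
    then have "\<bar>\<bar>p\<bar> - \<bar>r\<bar>\<bar> = d * s" "\<bar>p\<bar> * \<bar>r\<bar> = p * r"
      using s(4) by (auto simp: zero_less_mult_iff)
    then show ?thesis using abs_main by simp
  next
    case False
    then have "p * r < 0" using nz by (simp add: less_le)
    then have "1 / (p * r) < 0" by (rule divide_pos_neg[OF zero_less_one])
    then have "\<bar>3 - 1 / (p * r)\<bar> \<ge> 1" by linarith
    from sd[OF this] s(2) show ?thesis by linarith
  qed
qed

text \<open>Covering the set by an interval bounds its size without any question of measurability.\<close>

lemma cover_bounded_diameter:
  fixes T :: "real set"
  assumes "\<And>x y. x \<in> T \<Longrightarrow> y \<in> T \<Longrightarrow> \<bar>x - y\<bar> \<le> d"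
  obtains J where "J \<in> sets borel" "T \<subseteq> J" "emeasure lborel J \<le> ennreal (2 * d)"
proof (cases "T = {}")
  case True
  with that[of "{}"] show thesis by simp
next
  case False
  then obtain x where x: "x \<in> T" by blast
  with assms[OF x x] have d: "d \<ge> 0" by simp
  show thesis
  proof (rule that)
    show "{x - d..x + d} \<in> sets borel" by simp
    show "T \<subseteq> {x - d..x + d}" using assms[OF x] by (force simp: abs_le_iff)
    show "emeasure lborel {x - d..x + d} \<le> ennreal (2 * d)" using d by simp
  qed
qed

lemma cover_by_classes:
  fixes T :: "real set" and cls :: "real \<Rightarrow> 'i"
  assumes I: "finite I" "cls ` T \<subseteq> I" and d: "d \<ge> 0"
    and diam: "\<And>x y. x \<in> T \<Longrightarrow> y \<in> T \<Longrightarrow> cls x = cls y \<Longrightarrow> \<bar>x - y\<bar> \<le> d"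
  obtains J where "J \<in> sets borel" "T \<subseteq> J" "emeasure lborel J \<le> ennreal (2 * real (card I) * d)"
proof -
  have "\<exists>J. J \<in> sets borel \<and> {x\<in>T. cls x = i} \<subseteq> J \<and> emeasure lborel J \<le> ennreal (2 * d)" for i
    by (rule cover_bounded_diameter[of "{x\<in>T. cls x = i}" d]) (use diam in auto)
  then obtain J where J: "\<And>i. J i \<in> sets borel" "\<And>i. {x\<in>T. cls x = i} \<subseteq> J i"
      "\<And>i. emeasure lborel (J i) \<le> ennreal (2 * d)"
    by metis
  show thesis
  proof (rule that)
    show "(\<Union>i\<in>I. J i) \<in> sets borel" using I J by (intro sets.finite_UN) auto
    show "T \<subseteq> (\<Union>i\<in>I. J i)" using I J(2) by fastforce
    have "emeasure lborel (\<Union>i\<in>I. J i) \<le> (\<Sum>i\<in>I. emeasure lborel (J i))"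
      using I J by (intro emeasure_subadditive_finite) auto
    also have "\<dots> \<le> (\<Sum>i\<in>I. ennreal (2 * d))" by (intro sum_mono J)
    also have "\<dots> = ennreal (2 * real (card I) * d)"
      using d by (simp add: ennreal_of_nat_eq_real_of_nat ennreal_mult[symmetric] mult_ac)
    finally show "emeasure lborel (\<Union>i\<in>I. J i) \<le> ennreal (2 * real (card I) * d)" .
  qed
qed

text \<open>The four classes are given by the side of the vertex and the side of the critical value. Within a
  class the phase difference grows at least like \<open>\<bar>v\<bar> * (x - y)\<^sup>2 / 10\<close>. The gap in the range of
  \<open>\<bar>x\<bar>\<close> keeps the two degeneracies apart.\<close>

lemma phase_gap_sublevel_quadratic:
  fixes v t M :: real
  assumes v: "v \<noteq> 0" and M: "M \<ge> 0"
    and T: "\<And>x. x \<in> T \<Longrightarrow> x \<noteq> 0 \<and> x + v \<noteq> 0 \<and> (\<bar>x\<bar> \<le> 1/3 \<or> \<bar>x\<bar> \<ge> 2) \<and> \<bar>phase_gap v x - t\<bar> \<le> M"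
  obtains J where "J \<in> sets borel" "T \<subseteq> J" "emeasure lborel J \<le> ennreal (8 * sqrt (20 * M / \<bar>v\<bar>))"
proof -
  define cls where "cls x = (0 \<le> 2 * x + v, 3 * (x * (x + v))\<^sup>2 \<le> 1)" for x :: real
  have "\<bar>x - y\<bar> \<le> sqrt (20 * M / \<bar>v\<bar>)" if xy: "x \<in> T" "y \<in> T" "cls x = cls y" for x y
  proof -
    let ?p = "x * (x + v)" and ?r = "y * (y + v)"
    have same: "0 \<le> (2 * x + v) * (2 * y + v)"
      using xy(3) by (auto simp: cls_def zero_le_mult_iff)
    \<comment> \<open>If \<open>\<bar>u\<bar>\<close> is at most 1/3 then \<open>\<bar>u + v\<bar>\<close> is at least 3/2; if it is at least 2 then \<open>\<bar>u + v\<bar>\<close> is at most 1/3.\<close>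
    have apart: "\<bar>2 * u + v\<bar> \<ge> 1" if u: "u \<in> T" "1/2 \<le> \<bar>u * (u + v)\<bar>" "\<bar>u * (u + v)\<bar> \<le> 2/3" for u
    proof -
      have tri: "\<bar>u + v\<bar> \<le> \<bar>2 * u + v\<bar> + \<bar>u\<bar>" "\<bar>u\<bar> \<le> \<bar>2 * u + v\<bar> + \<bar>u + v\<bar>"
        using abs_triangle_ineq4[of "2 * u + v" u] abs_triangle_ineq4[of "2 * u + v" "u + v"] by simp_all
      show ?thesis
      proof (cases "\<bar>u\<bar> \<le> 1/3")
        case True
        have "1/2 \<le> \<bar>u\<bar> * \<bar>u + v\<bar>" using u(2) by (simp add: abs_mult)
        also have "\<dots> \<le> 1/3 * \<bar>u + v\<bar>" using True by (intro mult_right_mono) auto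
        finally show ?thesis using True tri(1) by simp
      next
        case False
        then have "\<bar>u\<bar> \<ge> 2" using T[OF u(1)] by blast
        then have "2 * \<bar>u + v\<bar> \<le> \<bar>u\<bar> * \<bar>u + v\<bar>" by (intro mult_right_mono) auto
        also have "\<dots> \<le> 2/3" using u(3) by (simp add: abs_mult)
        finally show ?thesis using \<open>\<bar>u\<bar> \<ge> 2\<close> tri(2) by simp
      qed
    qed
    have diff: "\<bar>phase_gap v x - phase_gap v y\<bar> =
        \<bar>v\<bar> * (\<bar>x - y\<bar> * (\<bar>x + y + v\<bar> * \<bar>3 - 1 / (?p * ?r)\<bar>))"
      using T xy by (simp add: phase_gap_diff abs_mult)
    have "\<bar>x - y\<bar> / 10 \<le> \<bar>x + y + v\<bar> * \<bar>3 - 1 / (?p * ?r)\<bar>"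
    proof (rule critical_factor)
      show "?p \<noteq> 0" "?r \<noteq> 0" using T xy by simp_all
      show "(3 * ?p\<^sup>2 \<le> 1 \<and> 3 * ?r\<^sup>2 \<le> 1) \<or> (3 * ?p\<^sup>2 \<ge> 1 \<and> 3 * ?r\<^sup>2 \<ge> 1)"
        using xy(3) by (auto simp: cls_def)
      show "1 \<le> \<bar>x + y + v\<bar>" if "1/2 \<le> \<bar>?p\<bar>" "\<bar>?p\<bar> \<le> 2/3" "1/2 \<le> \<bar>?r\<bar>" "\<bar>?r\<bar> \<le> 2/3"
        using apart[OF xy(1)] apart[OF xy(2)] that abs_diff_le_abs_sum_same_sign(2)[OF same] by auto
      show "\<bar>x - y\<bar> \<le> \<bar>x + y + v\<bar>" by (rule abs_diff_le_abs_sum_same_sign(1)[OF same])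
      show "\<bar>?p - ?r\<bar> = \<bar>x - y\<bar> * \<bar>x + y + v\<bar>"
        by (simp add: abs_mult[symmetric] algebra_simps)
    qed auto
    then have "\<bar>v\<bar> * (\<bar>x - y\<bar> * (\<bar>x - y\<bar> / 10)) \<le> \<bar>phase_gap v x - phase_gap v y\<bar>"
      unfolding diff by (intro mult_left_mono) auto
    also have "\<dots> \<le> 2 * M" using T[OF xy(1)] T[OF xy(2)] by linarith
    finally have "\<bar>x - y\<bar>\<^sup>2 \<le> 20 * M / \<bar>v\<bar>"
      using v by (simp add: pos_le_divide_eq power2_eq_square mult_ac)
    then show ?thesis by (rule real_le_rsqrt)
  qed
  moreover have "card (UNIV :: (bool \<times> bool) set) = 4"
    by (subst UNIV_Times_UNIV[symmetric], subst card_cartesian_product) simp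
  ultimately show thesis
    using cover_by_classes[of "UNIV :: (bool \<times> bool) set" cls T "sqrt (20 * M / \<bar>v\<bar>)"] M that
    by auto
qed

text \<open>Here \<open>p x * p y \<le> 1/4\<close>, so the last factor in \<open>phase_gap_diff\<close> is at least 1 in modulus, and on
  one side of the vertex the factor \<open>\<bar>x + y + v\<bar>\<close> is at least \<open>\<kappa>\<close>.\<close>

lemma phase_gap_sublevel_linear:
  fixes v t M \<kappa> :: real
  assumes v: "v \<noteq> 0" and M: "M \<ge> 0" and \<kappa>: "\<kappa> > 0"
    and T: "\<And>x. x \<in> T \<Longrightarrow> x * (x + v) < 0 \<and> x * (x + v) \<ge> - 1/2 \<and> \<kappa> \<le> \<bar>2 * x + v\<bar> \<and> \<bar>phase_gap v x - t\<bar> \<le> M"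
  obtains J where "J \<in> sets borel" "T \<subseteq> J" "emeasure lborel J \<le> ennreal (8 * M / (\<bar>v\<bar> * \<kappa>))"
proof -
  define cls where "cls x \<longleftrightarrow> 0 \<le> 2 * x + v" for x :: real
  have "\<bar>x - y\<bar> \<le> 2 * M / (\<bar>v\<bar> * \<kappa>)" if xy: "x \<in> T" "y \<in> T" "cls x = cls y" for x y
  proof -
    let ?p = "x * (x + v)" and ?r = "y * (y + v)"
    have same: "0 \<le> (2 * x + v) * (2 * y + v)"
      using xy(3) by (auto simp: cls_def zero_le_mult_iff)
    have nz: "x \<noteq> 0" "x + v \<noteq> 0" "y \<noteq> 0" "y + v \<noteq> 0" using T[OF xy(1)] T[OF xy(2)] by auto
    have pr: "?p * ?r > 0" "?p * ?r \<le> 1/4"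
      using T[OF xy(1)] T[OF xy(2)] mult_mono[of "- ?p" "1/2" "- ?r" "1/2"] by (auto simp: mult_neg_neg)
    then have "1 / (?p * ?r) \<ge> 4" by (simp add: pos_le_divide_eq)
    then have fac: "\<bar>3 - 1 / (?p * ?r)\<bar> \<ge> 1" by linarith
    have sum: "\<kappa> \<le> \<bar>x + y + v\<bar>"
      using T[OF xy(1)] T[OF xy(2)] abs_diff_le_abs_sum_same_sign(2)[OF same] by simp
    have diff: "\<bar>phase_gap v x - phase_gap v y\<bar> =
        \<bar>v\<bar> * (\<bar>x - y\<bar> * (\<bar>x + y + v\<bar> * \<bar>3 - 1 / (?p * ?r)\<bar>))"
      unfolding phase_gap_diff[OF nz] abs_mult by (simp only: mult_ac)
    have "\<kappa> * 1 \<le> \<bar>x + y + v\<bar> * \<bar>3 - 1 / (?p * ?r)\<bar>"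
      using sum fac \<kappa> by (intro mult_mono) auto
    then have "\<bar>v\<bar> * (\<bar>x - y\<bar> * (\<kappa> * 1)) \<le> \<bar>phase_gap v x - phase_gap v y\<bar>"
      unfolding diff by (intro mult_left_mono) auto
    also have "\<dots> \<le> 2 * M" using T[OF xy(1)] T[OF xy(2)] by linarith
    finally show ?thesis using v \<kappa> by (simp add: pos_le_divide_eq mult_ac)
  qed
  then show thesis
    using cover_by_classes[of "UNIV :: bool set" cls T "2 * M / (\<bar>v\<bar> * \<kappa>)"] M \<kappa> that by auto
qed


section \<open>Measure of the resonant sets\<close>

lemma strip_measure:
  fixes \<theta> :: "real \<Rightarrow> real"
  assumes [measurable]: "J \<in> sets borel" "\<theta> \<in> borel_measurable borel" and R: "R \<ge> 0"
  shows "{(\<tau>, \<xi>). \<xi> \<in> J \<and> \<bar>\<tau> - \<theta> \<xi>\<bar> \<le> R} \<in> sets borel"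
    and "emeasure lborel {(\<tau>, \<xi>). \<xi> \<in> J \<and> \<bar>\<tau> - \<theta> \<xi>\<bar> \<le> R} \<le> ennreal (2 * R) * emeasure lborel J"
proof -
  let ?S = "{(\<tau>, \<xi>). \<xi> \<in> J \<and> \<bar>\<tau> - \<theta> \<xi>\<bar> \<le> R}"
  have "Measurable.pred (borel \<Otimes>\<^sub>M borel) (\<lambda>(\<tau>, \<xi>). \<xi> \<in> J \<and> \<bar>\<tau> - \<theta> \<xi>\<bar> \<le> R)"
    by measurable
  then have S: "?S \<in> sets (borel \<Otimes>\<^sub>M borel)"
    by (simp add: pred_def space_pair_measure)
  then show "?S \<in> sets borel" by (simp only: borel_prod)
  have "emeasure lborel ?S = emeasure (lborel \<Otimes>\<^sub>M lborel) ?S" by (simp add: lborel_prod)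
  also have "\<dots> = (\<integral>\<^sup>+\<xi>. emeasure lborel ((\<lambda>\<tau>. (\<tau>, \<xi>)) -` ?S) \<partial>lborel)"
    by (rule lborel_pair.emeasure_pair_measure_alt2) (use S in \<open>simp add: sets_pair_measure_cong[OF sets_lborel sets_lborel]\<close>)
  also have "\<dots> = (\<integral>\<^sup>+\<xi>. ennreal (2 * R) * indicator J \<xi> \<partial>lborel)"
  proof (rule nn_integral_cong)
    fix \<xi>
    have "(\<lambda>\<tau>. (\<tau>, \<xi>)) -` ?S = (if \<xi> \<in> J then {\<theta> \<xi> - R..\<theta> \<xi> + R} else {})"
      by (auto simp: abs_le_iff)
    then show "emeasure lborel ((\<lambda>\<tau>. (\<tau>, \<xi>)) -` ?S) = ennreal (2 * R) * indicator J \<xi>"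
      using R by simp
  qed
  also have "\<dots> = ennreal (2 * R) * emeasure lborel J" by (simp add: nn_integral_cmult)
  finally show "emeasure lborel ?S \<le> ennreal (2 * R) * emeasure lborel J" by simp
qed

lemma modulation_eq: "modulation \<tau> \<xi> = \<tau> - phase \<xi>"
  by (simp add: modulation_def phase_def)

lemma borel_measurable_phase [measurable]: "phase \<in> borel_measurable borel"
  unfolding phase_def by measurable

text \<open>Both modulation conditions confine \<open>\<tau>\<close> for given \<open>\<xi>\<close>; the stronger one gives the width of the strip.
  Their difference eliminates \<open>\<tau>\<close> and leaves a condition on \<open>\<xi>\<close> with the weaker bound. The two
  frequencies at which the phase is singular contribute a null set.\<close>

lemma resonant_set_measure:
  assumes E: "E \<in> sets borel"
    and B: "\<And>\<tau> \<xi>. (\<tau>, \<xi>) \<in> E \<Longrightarrow> (\<tau>, \<xi>) \<in> B_set l \<and> (\<tau> + \<tau>\<^sub>2, \<xi> + \<xi>\<^sub>2) \<in> B_set k"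
    and J: "J \<in> sets borel"
       "{\<xi> \<in> snd ` E. \<xi> \<noteq> 0 \<and> \<xi> + \<xi>\<^sub>2 \<noteq> 0 \<and> \<bar>phase_gap \<xi>\<^sub>2 \<xi> - \<tau>\<^sub>2\<bar> \<le> 4 * 2 ^ max k l} \<subseteq> J"
  shows "emeasure lborel E \<le> ennreal (4 * 2 ^ min k l) * emeasure lborel J"
proof -
  \<comment> \<open>The phases are singular at these two frequencies, where the hypothesis on \<open>J\<close> says nothing.\<close>
  let ?J = "J \<union> {0, - \<xi>\<^sub>2}"
  have J': "?J \<in> sets borel" using J by auto
  have mJ: "emeasure lborel ?J = emeasure lborel J"
    by (rule emeasure_Un_null_set) (use J in \<open>auto intro!: finite_imp_null_set_lborel\<close>)
  have mod: "\<bar>\<tau> - phase \<xi>\<bar> \<le> 2 * 2 ^ l" "\<bar>\<tau> + \<tau>\<^sub>2 - phase (\<xi> + \<xi>\<^sub>2)\<bar> \<le> 2 * 2 ^ k"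
      if "(\<tau>, \<xi>) \<in> E" for \<tau> \<xi>
    using B[OF that] by (auto simp: B_set_def jb_def modulation_eq)
  have inJ: "\<xi> \<in> ?J" if w: "(\<tau>, \<xi>) \<in> E" for \<tau> \<xi>
  proof -
    have "\<bar>phase_gap \<xi>\<^sub>2 \<xi> - \<tau>\<^sub>2\<bar> \<le> 2 * 2 ^ l + 2 * 2 ^ k"
      using mod[OF w] by (simp add: phase_gap_def)
    also have "\<dots> \<le> 2 * 2 ^ max k l + 2 * 2 ^ max k l"
      by (intro add_mono mult_left_mono power_increasing) auto
    finally have "\<bar>phase_gap \<xi>\<^sub>2 \<xi> - \<tau>\<^sub>2\<bar> \<le> 4 * 2 ^ max k l" by simp
    moreover have "\<xi> \<in> snd ` E" using w by force
    ultimately show ?thesis using J(2) by (auto simp: add_eq_0_iff)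
  qed
  have "\<exists>\<theta>. \<theta> \<in> borel_measurable borel \<and> (\<forall>\<tau> \<xi>. (\<tau>, \<xi>) \<in> E \<longrightarrow> \<bar>\<tau> - \<theta> \<xi>\<bar> \<le> 2 * 2 ^ min k l)"
  proof (cases "l \<le> k")
    case True
    then show ?thesis using mod(1) by (intro exI[of _ phase]) (auto simp: min_def)
  next
    case False
    then show ?thesis using mod(2)
      by (intro exI[of _ "\<lambda>\<xi>. phase (\<xi> + \<xi>\<^sub>2) - \<tau>\<^sub>2"]) (auto simp: min_def algebra_simps)
  qed
  then obtain \<theta> where \<theta>: "\<theta> \<in> borel_measurable borel"
      "\<And>\<tau> \<xi>. (\<tau>, \<xi>) \<in> E \<Longrightarrow> \<bar>\<tau> - \<theta> \<xi>\<bar> \<le> 2 * 2 ^ min k l" by blast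
  have "emeasure lborel E \<le> emeasure lborel {(\<tau>, \<xi>). \<xi> \<in> ?J \<and> \<bar>\<tau> - \<theta> \<xi>\<bar> \<le> 2 * 2 ^ min k l}"
    using inJ \<theta> strip_measure(1)[OF J' \<theta>(1), of "2 * 2 ^ min k l"]
    by (intro emeasure_mono) auto
  also have "\<dots> \<le> ennreal (2 * (2 * 2 ^ min k l)) * emeasure lborel ?J"
    by (rule strip_measure(2)[OF J' \<theta>(1)]) simp
  finally show ?thesis unfolding mJ by simp
qed

text \<open>The bound \<open>2 ^ min k l * sqrt (2 ^ max k l) \<le> 2 ^ l * sqrt (2 ^ k)\<close> is an equality for \<open>l \<le> k\<close> and loses
  \<open>sqrt (2 ^ (l - k))\<close> otherwise.\<close>

lemma resonant_measure_frequency_gap: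
  assumes E: "E \<in> sets borel"
    and B: "\<And>\<tau> \<xi>. (\<tau>, \<xi>) \<in> E \<Longrightarrow> (\<tau>, \<xi>) \<in> B_set l \<and> (\<tau> + \<tau>\<^sub>2, \<xi> + \<xi>\<^sub>2) \<in> B_set k"
    and gap: "\<And>\<tau> \<xi>. (\<tau>, \<xi>) \<in> E \<Longrightarrow> \<bar>\<xi>\<bar> \<le> 1/3 \<or> \<bar>\<xi>\<bar> \<ge> 2"
    and nz: "\<xi>\<^sub>2 \<noteq> 0"
  shows "emeasure lborel E \<le> ennreal (2 ^ l) * ennreal (289 * sqrt (2 ^ k) / sqrt \<bar>\<xi>\<^sub>2\<bar>)"
proof -
  let ?M = "4 * 2 ^ max k l :: real"
  have gap': "\<bar>\<xi>\<bar> \<le> 1/3 \<or> \<bar>\<xi>\<bar> \<ge> 2" if "\<xi> \<in> snd ` E" for \<xi>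
  proof -
    from that obtain \<tau> where "(\<tau>, \<xi>) \<in> E" by auto
    then show ?thesis by (rule gap)
  qed
  obtain J where J: "J \<in> sets borel"
      "{\<xi> \<in> snd ` E. \<xi> \<noteq> 0 \<and> \<xi> + \<xi>\<^sub>2 \<noteq> 0 \<and> \<bar>phase_gap \<xi>\<^sub>2 \<xi> - \<tau>\<^sub>2\<bar> \<le> ?M} \<subseteq> J"
      "emeasure lborel J \<le> ennreal (8 * sqrt (20 * ?M / \<bar>\<xi>\<^sub>2\<bar>))"
    by (rule phase_gap_sublevel_quadratic[OF nz, of ?M
          "{\<xi> \<in> snd ` E. \<xi> \<noteq> 0 \<and> \<xi> + \<xi>\<^sub>2 \<noteq> 0 \<and> \<bar>phase_gap \<xi>\<^sub>2 \<xi> - \<tau>\<^sub>2\<bar> \<le> ?M}" \<tau>\<^sub>2])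
       (use gap' in auto)
  have "emeasure lborel E \<le> ennreal (4 * 2 ^ min k l) * emeasure lborel J"
    by (rule resonant_set_measure[OF E B J(1,2)])
  also have "\<dots> \<le> ennreal (4 * 2 ^ min k l) * ennreal (8 * sqrt (20 * ?M / \<bar>\<xi>\<^sub>2\<bar>))"
    by (intro mult_left_mono J) simp
  also have "\<dots> = ennreal (32 * sqrt 80 * (2 ^ min k l * sqrt (2 ^ max k l)) / sqrt \<bar>\<xi>\<^sub>2\<bar>)"
    by (simp add: ennreal_mult[symmetric] real_sqrt_mult real_sqrt_divide)
  also have "\<dots> \<le> ennreal (2 ^ l * (289 * sqrt (2 ^ k) / sqrt \<bar>\<xi>\<^sub>2\<bar>))"
  proof (rule ennreal_leI)
    \<comment> \<open>The factor 32 is \<open>4 * 8\<close>, and \<open>32 * 9\<close> is less than \<open>289 = 17\<^sup>2\<close>, which has a rational square root.\<close>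
    have "sqrt 80 \<le> 9" by (rule real_le_lsqrt) auto
    moreover have "2 ^ min k l * sqrt (2 ^ max k l) \<le> 2 ^ l * sqrt (2 ^ k)"
    proof (cases "l \<le> k")
      case False
      then have "sqrt (2 ^ k) * sqrt (2 ^ l) \<le> sqrt (2 ^ l) * sqrt (2 ^ l)"
        by (intro mult_right_mono real_sqrt_le_mono power_increasing) auto
      then have "sqrt (2 ^ k) * (sqrt (2 ^ k) * sqrt (2 ^ l)) \<le> sqrt (2 ^ k) * (sqrt (2 ^ l) * sqrt (2 ^ l))"
        by (rule mult_left_mono) simp
      moreover have "sqrt (2 ^ k) * (sqrt (2 ^ k) * sqrt (2 ^ l)) = 2 ^ k * sqrt (2 ^ l)"
        by (simp add: mult.assoc[symmetric])
      moreover have "sqrt (2 ^ k) * (sqrt (2 ^ l) * sqrt (2 ^ l)) = 2 ^ l * sqrt (2 ^ k)"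
        by simp
      ultimately show ?thesis using False by (simp add: min_def max_def mult.commute)
    qed (simp add: min_def max_def)
    ultimately have "32 * sqrt 80 * (2 ^ min k l * sqrt (2 ^ max k l)) \<le> 289 * (2 ^ l * sqrt (2 ^ k))"
      using mult_mono[of "32 * sqrt 80" 289] by simp
    then show "32 * sqrt 80 * (2 ^ min k l * sqrt (2 ^ max k l)) / sqrt \<bar>\<xi>\<^sub>2\<bar>
        \<le> 2 ^ l * (289 * sqrt (2 ^ k) / sqrt \<bar>\<xi>\<^sub>2\<bar>)"
      using nz by (simp add: divide_right_mono mult_ac)
  qed
  finally show ?thesis by (subst ennreal_mult[symmetric]) simp_all
qed

lemma resonant_measure_transversal:
  assumes E: "E \<in> sets borel"
    and B: "\<And>\<tau> \<xi>. (\<tau>, \<xi>) \<in> E \<Longrightarrow> (\<tau>, \<xi>) \<in> B_set l \<and> (\<tau> + \<tau>\<^sub>2, \<xi> + \<xi>\<^sub>2) \<in> B_set k"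
    and trans: "\<And>\<tau> \<xi>. (\<tau>, \<xi>) \<in> E \<Longrightarrow> \<xi> \<noteq> 0 \<Longrightarrow> \<xi> + \<xi>\<^sub>2 \<noteq> 0 \<Longrightarrow>
        \<xi> * (\<xi> + \<xi>\<^sub>2) < 0 \<and> \<xi> * (\<xi> + \<xi>\<^sub>2) \<ge> - 1/2 \<and> \<kappa> \<le> \<bar>2 * \<xi> + \<xi>\<^sub>2\<bar>"
    and \<kappa>: "\<kappa> > 0" and nz: "\<xi>\<^sub>2 \<noteq> 0"
  shows "emeasure lborel E \<le> ennreal (2 ^ l) * ennreal (289 * 2 ^ k / \<kappa> / \<bar>\<xi>\<^sub>2\<bar>)"
proof -
  let ?M = "4 * 2 ^ max k l :: real"
  obtain J where J: "J \<in> sets borel"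
      "{\<xi> \<in> snd ` E. \<xi> \<noteq> 0 \<and> \<xi> + \<xi>\<^sub>2 \<noteq> 0 \<and> \<bar>phase_gap \<xi>\<^sub>2 \<xi> - \<tau>\<^sub>2\<bar> \<le> ?M} \<subseteq> J"
      "emeasure lborel J \<le> ennreal (8 * ?M / (\<bar>\<xi>\<^sub>2\<bar> * \<kappa>))"
    by (rule phase_gap_sublevel_linear[OF nz _ \<kappa>, of ?M
          "{\<xi> \<in> snd ` E. \<xi> \<noteq> 0 \<and> \<xi> + \<xi>\<^sub>2 \<noteq> 0 \<and> \<bar>phase_gap \<xi>\<^sub>2 \<xi> - \<tau>\<^sub>2\<bar> \<le> ?M}" \<tau>\<^sub>2])
       (use trans in auto)
  have "emeasure lborel E \<le> ennreal (4 * 2 ^ min k l) * emeasure lborel J"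
    by (rule resonant_set_measure[OF E B J(1,2)])
  also have "\<dots> \<le> ennreal (4 * 2 ^ min k l) * ennreal (8 * ?M / (\<bar>\<xi>\<^sub>2\<bar> * \<kappa>))"
    by (intro mult_left_mono J) simp
  also have "\<dots> = ennreal (128 * (2 ^ min k l * 2 ^ max k l) / (\<bar>\<xi>\<^sub>2\<bar> * \<kappa>))"
    using \<kappa> by (simp add: ennreal_mult[symmetric])
  also have "2 ^ min k l * 2 ^ max k l = (2 ^ l * 2 ^ k :: real)"
    by (simp add: min_def max_def)
  also have "ennreal (128 * (2 ^ l * 2 ^ k) / (\<bar>\<xi>\<^sub>2\<bar> * \<kappa>)) \<le> ennreal (2 ^ l * (289 * 2 ^ k / \<kappa> / \<bar>\<xi>\<^sub>2\<bar>))"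
    using \<kappa> nz by (intro ennreal_leI) (simp add: field_simps)
  finally show ?thesis using \<kappa> by (subst ennreal_mult[symmetric]) simp_all
qed


section \<open>Frequency constraints from the resonance condition\<close>

lemma resonance_product_bound:
  fixes \<xi> \<xi>\<^sub>1 \<xi>\<^sub>2 :: real
  assumes neg: "\<xi> * \<xi>\<^sub>1 < 0" and nz: "\<xi>\<^sub>2 \<noteq> 0"
    and res: "\<bar>1 + 4 / (3 * \<xi> * \<xi>\<^sub>1 * \<xi>\<^sub>2\<^sup>2)\<bar> \<le> 1/2"
  shows "- (\<xi> * \<xi>\<^sub>1) * \<xi>\<^sub>2\<^sup>2 \<le> 8/3"
proof -
  define m where "m = - (\<xi> * \<xi>\<^sub>1) * \<xi>\<^sub>2\<^sup>2"
  have m: "m > 0" unfolding m_def using neg nz by (intro mult_pos_pos) auto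
  have "3 * \<xi> * \<xi>\<^sub>1 * \<xi>\<^sub>2\<^sup>2 = - (3 * m)" by (simp add: m_def)
  with res have "\<bar>1 - 4 / (3 * m)\<bar> \<le> 1/2" by simp
  then have "4 / (3 * m) \<ge> 1/2" by linarith
  then have "m \<le> 8/3" using m by (simp add: field_simps)
  then show ?thesis by (simp add: m_def)
qed

text \<open>If \<open>1/3 < \<bar>\<xi>\<^sub>1\<bar> < 2\<close>, then \<open>\<bar>\<xi>\<bar> \<ge> 2\<close> because the frequencies have opposite signs and their moduli
  differ by at least 2. Then \<open>\<bar>\<xi> * \<xi>\<^sub>1\<bar> * (\<xi> - \<xi>\<^sub>1)\<^sup>2 > 1/3 * 2 * 4 = 8/3\<close>, against
  \<open>resonance_product_bound\<close>.\<close>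

lemma resonance_frequency_gap:
  fixes \<xi> \<xi>\<^sub>1 :: real
  assumes sgn: "\<xi> * \<xi>\<^sub>1 \<le> 0" and nz: "\<xi> \<noteq> 0" and far: "2 \<le> \<bar>\<xi>\<^sub>1 + \<xi>\<bar>"
    and res: "3 * \<xi> * \<xi>\<^sub>1 * (\<xi> - \<xi>\<^sub>1)\<^sup>2 \<noteq> 0 \<Longrightarrow> \<bar>1 + 4 / (3 * \<xi> * \<xi>\<^sub>1 * (\<xi> - \<xi>\<^sub>1)\<^sup>2)\<bar> \<le> 1/2"
  shows "\<bar>\<xi>\<^sub>1\<bar> \<le> 1/3 \<or> \<bar>\<xi>\<^sub>1\<bar> \<ge> 2"
proof (rule ccontr)
  assume "\<not> ?thesis"
  then have mid: "1/3 < \<bar>\<xi>\<^sub>1\<bar>" "\<bar>\<xi>\<^sub>1\<bar> < 2" by auto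
  have neg: "\<xi> * \<xi>\<^sub>1 < 0" using sgn nz mid by (auto simp: less_le)
  have big: "\<bar>\<xi>\<bar> \<ge> 2" "\<bar>\<xi> - \<xi>\<^sub>1\<bar> \<ge> 2"
    using neg far mid by (auto simp: mult_less_0_iff abs_if split: if_splits)
  then have "- (\<xi> * \<xi>\<^sub>1) * (\<xi> - \<xi>\<^sub>1)\<^sup>2 \<le> 8/3"
    using neg by (intro resonance_product_bound res) auto
  moreover have "- (\<xi> * \<xi>\<^sub>1) = \<bar>\<xi>\<^sub>1\<bar> * \<bar>\<xi>\<bar>" using neg by (simp add: abs_mult[symmetric] mult.commute)
  moreover have "1/3 * 2 < \<bar>\<xi>\<^sub>1\<bar> * \<bar>\<xi>\<bar>" using mid big by (intro mult_less_le_imp_less) auto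
  moreover have "2\<^sup>2 \<le> (\<xi> - \<xi>\<^sub>1)\<^sup>2" using power_mono[OF big(2), of 2] by simp
  ultimately show False
    using mult_less_le_imp_less[of "1/3 * 2" "\<bar>\<xi>\<^sub>1\<bar> * \<bar>\<xi>\<bar>" "2\<^sup>2" "(\<xi> - \<xi>\<^sub>1)\<^sup>2"] by simp
qed

text \<open>With \<open>r = - \<xi> * \<xi>\<^sub>1\<close> one has \<open>(\<xi> - \<xi>\<^sub>1)\<^sup>2 = (\<xi> + \<xi>\<^sub>1)\<^sup>2 + 4 * r \<ge> 4 + 4 * r\<close>, so \<open>r > 1/2\<close> would
  contradict \<open>resonance_product_bound\<close>.\<close>

lemma resonance_small_product:
  fixes \<xi> \<xi>\<^sub>1 :: real
  assumes sgn: "\<xi> * \<xi>\<^sub>1 \<le> 0" and nz: "\<xi> \<noteq> 0" "\<xi>\<^sub>1 \<noteq> 0" and far: "2 \<le> \<bar>\<xi>\<^sub>1 + \<xi>\<bar>"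
    and res: "3 * \<xi> * \<xi>\<^sub>1 * (\<xi> - \<xi>\<^sub>1)\<^sup>2 \<noteq> 0 \<Longrightarrow> \<bar>1 + 4 / (3 * \<xi> * \<xi>\<^sub>1 * (\<xi> - \<xi>\<^sub>1)\<^sup>2)\<bar> \<le> 1/2"
  shows "\<xi> * \<xi>\<^sub>1 < 0" "\<xi> * \<xi>\<^sub>1 \<ge> - 1/2"
proof -
  show neg: "\<xi> * \<xi>\<^sub>1 < 0" using sgn nz by (auto simp: less_le)
  then have ne: "\<xi> - \<xi>\<^sub>1 \<noteq> 0" by (auto simp: mult_less_0_iff)
  define r where "r = - (\<xi> * \<xi>\<^sub>1)"
  have r0: "r > 0" using neg by (simp add: r_def)
  have bound: "r * (\<xi> - \<xi>\<^sub>1)\<^sup>2 \<le> 8/3"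
    unfolding r_def using neg ne by (intro resonance_product_bound res) auto
  have "2\<^sup>2 \<le> (\<xi>\<^sub>1 + \<xi>)\<^sup>2" using power_mono[OF far, of 2] by simp
  moreover have "(\<xi> - \<xi>\<^sub>1)\<^sup>2 = (\<xi>\<^sub>1 + \<xi>)\<^sup>2 + 4 * r" by (simp add: r_def power2_eq_square algebra_simps)
  ultimately have "4 + 4 * r \<le> (\<xi> - \<xi>\<^sub>1)\<^sup>2" by simp
  then have "r * (4 + 4 * r) \<le> r * (\<xi> - \<xi>\<^sub>1)\<^sup>2" using r0 by (intro mult_left_mono) auto
  with bound have le: "r * (4 + 4 * r) \<le> 8/3" by linarith
  have "r \<le> 1/2"
  proof (rule ccontr)
    assume "\<not> r \<le> 1/2"
    then have "1/2 * 6 \<le> r * (4 + 4 * r)" by (intro mult_mono) auto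
    with le show False by simp
  qed
  then show "\<xi> * \<xi>\<^sub>1 \<ge> - 1/2" by (simp add: r_def)
qed


section \<open>Modulation pieces and the weighted estimate\<close>

lemma borel_measurable_modulation [measurable]:
  "(\<lambda>w. modulation (fst w) (snd w)) \<in> borel_measurable borel"
proof -
  have "(\<lambda>w. modulation (fst w) (snd w)) \<in> borel_measurable (borel \<Otimes>\<^sub>M borel)"
    unfolding modulation_def by measurable
  then show ?thesis by (simp only: borel_prod)
qed

lemma sets_B_set [measurable]: "B_set k \<in> sets borel"
proof -
  have "B_set k = {w \<in> space borel. 2 ^ k \<le> 1 + \<bar>modulation (fst w) (snd w)\<bar> \<and>
      1 + \<bar>modulation (fst w) (snd w)\<bar> < 2 ^ (k + 1)}"
    by (auto simp: B_set_def jb_def)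
  also have "\<dots> \<in> sets borel" by measurable
  finally show ?thesis .
qed

lemma disjoint_B_set: "disjoint_family B_set"
proof -
  have *: False if "w \<in> B_set l" "w \<in> B_set m" "l < m" for w l m
  proof -
    have "jb (modulation (fst w) (snd w)) < 2 ^ (l + 1)" "2 ^ m \<le> jb (modulation (fst w) (snd w))"
      using that(1,2) by (auto simp: B_set_def)
    moreover have "(2::real) ^ (l + 1) \<le> 2 ^ m" using that(3) by (intro power_increasing) auto
    ultimately show False by linarith
  qed
  show ?thesis
    unfolding disjoint_family_on_def
  proof (intro ballI impI)
    fix l m :: nat assume "l \<noteq> m"
    then show "B_set l \<inter> B_set m = {}" using *[of _ l m] *[of _ m l] by (cases l m rule: linorder_cases) auto
  qed
qed

lemma ex_B_set: "\<exists>l. w \<in> B_set l"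
proof -
  define x where "x = jb (modulation (fst w) (snd w))"
  have x: "1 \<le> x" by (simp add: x_def jb_def)
  define n where "n = (LEAST n. x < 2 ^ n)"
  have n: "x < 2 ^ n" unfolding n_def using real_arch_pow[of 2 x] by (auto intro: LeastI_ex)
  have "n \<noteq> 0"
  proof
    assume "n = 0" with n x show False by simp
  qed
  then obtain l where l: "n = Suc l" by (cases n) auto
  have "\<not> x < 2 ^ l" using not_less_Least[of l "\<lambda>n. x < 2 ^ n"] l by (simp add: n_def)
  then have "w \<in> B_set l" using n l by (auto simp: B_set_def x_def split: prod.splits)
  then show ?thesis ..
qed

text \<open>Because of this equality an estimate in terms of one representing function passes to the infimum
  even when the other factor on the right-hand side is infinite.\<close>

lemma Xhat_norm_eq:
  assumes F: "represents F u"
  shows "Xhat_norm s b u = Xhat_norm_fun s b F"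
proof -
  have "Xhat_norm_fun s b G = Xhat_norm_fun s b F" if "represents G u" for G
  proof -
    have eq: "AE z in lebesgue. G z = F z" by (rule represents_AE_unique[OF that F])
    have "L2_norm_on S (\<lambda>(\<tau>, \<xi>). of_real (w \<tau> \<xi>) * G (\<tau>, \<xi>)) = L2_norm_on S (\<lambda>(\<tau>, \<xi>). of_real (w \<tau> \<xi>) * F (\<tau>, \<xi>))"
      for S and w :: "real \<Rightarrow> real \<Rightarrow> real"
      unfolding L2_norm_on_def
    proof (rule arg_cong[where f = enn_sqrt], rule nn_integral_cong_AE)
      show "AE z in lebesgue.
          (ennreal (cmod (case z of (\<tau>, \<xi>) \<Rightarrow> of_real (w \<tau> \<xi>) * G (\<tau>, \<xi>))))\<^sup>2 * indicator S z =
          (ennreal (cmod (case z of (\<tau>, \<xi>) \<Rightarrow> of_real (w \<tau> \<xi>) * F (\<tau>, \<xi>))))\<^sup>2 * indicator S z"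
        using eq
      proof eventually_elim
        case (elim z)
        then show ?case by (cases z) simp
      qed
    qed
    note this[of _ "\<lambda>\<tau> \<xi>. jb \<xi> powr s * jb (modulation \<tau> \<xi>) powr b"]
    then show ?thesis unfolding Xhat_norm_fun_def by (simp only:)
  qed
  then have "Xhat_norm_fun s b ` {G. represents G u} = {Xhat_norm_fun s b F}"
    using F by blast
  then show ?thesis unfolding Xhat_norm_def by simp
qed

text \<open>The support condition selects a single term of the outer sum, where the outer square root undoes
  the square; on \<open>B_set l\<close> the weight \<open>jb (modulation \<tau> \<xi>)\<close> is at least \<open>2 ^ l\<close>.\<close>

lemma Xhat_norm_fun_ge:
  assumes S: "S \<subseteq> A_set j" and a: "\<And>w. a w = ennreal (cmod (F' w)) * indicator S w"
    and eq: "AE w in lborel. F w = F' w" and [measurable]: "F' \<in> borel_measurable borel" "S \<in> sets borel"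
  shows "(\<Sum>l. enn_sqrt (ennreal (2 ^ l) * (\<integral>\<^sup>+w\<in>S \<inter> B_set l. (a w)\<^sup>2 \<partial>lborel))) \<le> Xhat_norm_fun 0 (1/2) F"
proof -
  let ?h = "\<lambda>(\<tau>, \<xi>). of_real (jb \<xi> powr 0 * jb (modulation \<tau> \<xi>) powr (1/2)) * F (\<tau>, \<xi>)"
  let ?L = "\<lambda>i l. L2_norm_on (A_set i \<inter> B_set l) ?h"
  have "enn_sqrt (ennreal (2 ^ l) * (\<integral>\<^sup>+w\<in>S \<inter> B_set l. (a w)\<^sup>2 \<partial>lborel)) \<le> ?L j l" for l
    unfolding L2_norm_on_def nn_integral_completion
  proof (rule enn_sqrt_mono)
    have [measurable]: "a \<in> borel_measurable borel" unfolding a by measurable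
    have "ennreal (2 ^ l) * (\<integral>\<^sup>+w\<in>S \<inter> B_set l. (a w)\<^sup>2 \<partial>lborel) =
        (\<integral>\<^sup>+w. ennreal (2 ^ l) * ((a w)\<^sup>2 * indicator (S \<inter> B_set l) w) \<partial>lborel)"
      by (rule nn_integral_cmult[symmetric]) measurable
    also have "\<dots> \<le> (\<integral>\<^sup>+w\<in>A_set j \<inter> B_set l. (ennreal (cmod (?h w)))\<^sup>2 \<partial>lborel)"
      using eq
    proof (intro nn_integral_mono_AE, eventually_elim)
      case (elim w)
      show ?case
      proof (cases "w \<in> S \<inter> B_set l")
        case True
        obtain \<tau> \<xi> where w: "w = (\<tau>, \<xi>)" by (cases w)
        let ?m = "jb (modulation \<tau> \<xi>)"
        have m: "2 ^ l \<le> ?m" "0 < ?m" using True by (auto simp: w B_set_def jb_def)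
        have "(cmod (?h w))\<^sup>2 = (?m powr (1/2))\<^sup>2 * (cmod (F' w))\<^sup>2"
          using elim by (simp add: w norm_mult power_mult_distrib jb_def)
        also have "(?m powr (1/2))\<^sup>2 = ?m"
          using m(2) by (simp add: powr_half_sqrt)
        finally have h: "(cmod (?h w))\<^sup>2 = ?m * (cmod (F' w))\<^sup>2" .
        have "ennreal (2 ^ l) * (a w)\<^sup>2 = ennreal (2 ^ l * (cmod (F' w))\<^sup>2)"
          using True by (simp add: a ennreal_mult ennreal_power)
        also have "\<dots> \<le> ennreal ((cmod (?h w))\<^sup>2)"
          unfolding h by (intro ennreal_leI mult_right_mono m) simp
        also have "\<dots> = (ennreal (cmod (?h w)))\<^sup>2" by (simp add: ennreal_power)
        finally show ?thesis using True S by auto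
      qed simp
    qed
    finally show "ennreal (2 ^ l) * (\<integral>\<^sup>+w\<in>S \<inter> B_set l. (a w)\<^sup>2 \<partial>lborel)
        \<le> (\<integral>\<^sup>+w\<in>A_set j \<inter> B_set l. (ennreal (cmod (?h w)))\<^sup>2 \<partial>lborel)" .
  qed
  then have "(\<Sum>l. enn_sqrt (ennreal (2 ^ l) * (\<integral>\<^sup>+w\<in>S \<inter> B_set l. (a w)\<^sup>2 \<partial>lborel))) \<le> (\<Sum>l. ?L j l)"
    by (intro suminf_le) auto
  also have "\<dots> = enn_sqrt ((\<Sum>l. ?L j l)\<^sup>2)" by simp
  also have "\<dots> \<le> enn_sqrt (\<Sum>i. (\<Sum>l. ?L i l)\<^sup>2)"
    using sum_le_suminf[of "\<lambda>i. (\<Sum>l. ?L i l)\<^sup>2" "{j}"] by (intro enn_sqrt_mono) auto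
  finally show ?thesis unfolding Xhat_norm_fun_def .
qed

lemma AE_snd_nonzero: "AE v :: real \<times> real in lborel. snd v \<noteq> 0"
proof -
  have "{v :: real \<times> real. snd v = 0} = {v. (0, 1) \<bullet> v = 0}" by (auto simp: inner_prod_def)
  moreover have "negligible {v :: real \<times> real. (0, 1) \<bullet> v = 0}"
    by (rule negligible_hyperplane) (simp add: prod_eq_iff)
  ultimately have "{v :: real \<times> real. snd v = 0} \<in> null_sets lebesgue"
    by (simp add: negligible_iff_null_sets)
  from AE_not_in[OF this] have "AE v :: real \<times> real in lebesgue. snd v \<noteq> 0" by simp
  then show ?thesis by (simp add: AE_completion_iff)
qed

text \<open>\<open>convolution_bound_dyadic\<close> for \<open>a = \<bar>F\<bar>\<close> (in a Borel version cut off to the support) and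
  \<open>\<sigma> l = 2 ^ l\<close>. The power of \<open>\<xi>\<^sub>2\<close> in the overlap bound becomes the weight on \<open>g\<close>.\<close>

lemma weighted_convolution_estimate:
  fixes g :: "real \<times> real \<Rightarrow> complex" and c s :: real
  assumes F: "represents F f" and g: "schwartz g" and supp: "dist_support f \<subseteq> A_set j"
    and D [measurable]: "D \<in> sets borel" and c: "c \<ge> 0"
    and overlap: "\<And>l \<tau>\<^sub>2 \<xi>\<^sub>2. \<xi>\<^sub>2 \<noteq> 0 \<Longrightarrow>
      emeasure lborel {w \<in> dist_support f \<inter> B_set l. w + (\<tau>\<^sub>2, \<xi>\<^sub>2) \<in> D}
        \<le> ennreal (2 ^ l) * ennreal ((c * \<bar>\<xi>\<^sub>2\<bar> powr s)\<^sup>2)"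
  shows "L2_norm_on D (dist_conv f g)
    \<le> ennreal c * Xhat_norm_fun 0 (1/2) F * L2_norm_on UNIV (weight_xi s g)"
proof -
  let ?S = "dist_support f"
  have S [measurable]: "?S \<in> sets borel" using closed_dist_support by (rule borel_closed)
  have gm [measurable]: "g \<in> borel_measurable borel" by (rule schwartz_borel_measurable[OF g])
  have "F \<in> borel_measurable lebesgue" using F by (simp add: represents_def)
  then obtain F' where F' [measurable]: "F' \<in> borel_measurable lborel" and eq: "AE w in lborel. F w = F' w"
    by (rule completion_ex_borel_measurable_complex)
  have F'b [measurable]: "F' \<in> borel_measurable borel" using F' by simp
  have off: "AE w in lborel. w \<notin> ?S \<longrightarrow> F w = 0"
    using represents_zero_off_dist_support[OF F] by (simp add: AE_completion_iff)
  define a where "a w = ennreal (cmod (F' w)) * indicator ?S w" for w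
  have [measurable]: "a \<in> borel_measurable borel" unfolding a_def by measurable
  define G where "G v = ennreal (cmod (g v))" for v
  have [measurable]: "G \<in> borel_measurable borel" unfolding G_def by measurable
  define W where "W v = ennreal ((c * \<bar>snd v\<bar> powr s)\<^sup>2)" for v :: "real \<times> real"
  have "W \<in> borel_measurable (borel \<Otimes>\<^sub>M borel)" unfolding W_def by measurable
  then have [measurable]: "W \<in> borel_measurable borel" by (simp only: borel_prod)
  define X where "X = (\<Sum>l. enn_sqrt (ennreal (2 ^ l) * (\<integral>\<^sup>+w\<in>?S \<inter> B_set l. (a w)\<^sup>2 \<partial>lborel)))"
  have aeq: "AE w in lborel. ennreal (cmod (F w)) = a w"
    using eq off by eventually_elim (auto simp: a_def indicator_def)
  have "(\<integral>\<^sup>+z\<in>D. (ennreal (cmod (dist_conv f g z)))\<^sup>2 \<partial>lborel)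
      \<le> (\<integral>\<^sup>+z\<in>D. (\<integral>\<^sup>+w. a w * G (z - w) \<partial>lborel)\<^sup>2 \<partial>lborel)"
    unfolding G_def by (intro nn_integral_mono mult_right_mono power_mono norm_dist_conv_le[OF F g aeq]) auto
  also have "\<dots> \<le> X\<^sup>2 * (\<integral>\<^sup>+v. (G v)\<^sup>2 * W v \<partial>lborel)"
    unfolding X_def
  proof (rule convolution_bound_dyadic)
    show "AE w in lborel. a w = (\<Sum>l. a w * indicator (?S \<inter> B_set l) w)"
    proof (rule AE_I2)
      fix w
      obtain l where l: "w \<in> B_set l" using ex_B_set by blast
      have "(\<Sum>l. a w * indicator (?S \<inter> B_set l) w) = (\<Sum>l. a w * indicator (B_set l) w)"
        by (intro suminf_cong) (auto simp: a_def indicator_def)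
      also have "\<dots> = a w" by (rule suminf_cmult_indicator[OF disjoint_B_set l])
      finally show "a w = (\<Sum>l. a w * indicator (?S \<inter> B_set l) w)" ..
    qed
    show "AE v in lborel. emeasure lborel {w \<in> ?S \<inter> B_set l. w + v \<in> D} \<le> ennreal (2 ^ l) * W v" for l
      using AE_snd_nonzero by eventually_elim (use overlap in \<open>force simp: W_def\<close>)
  qed auto
  also have "(\<integral>\<^sup>+v. (G v)\<^sup>2 * W v \<partial>lborel) = (\<integral>\<^sup>+v. ennreal (c\<^sup>2) * (ennreal (cmod (weight_xi s g v)))\<^sup>2 \<partial>lborel)"
    by (intro nn_integral_cong)
       (auto simp: G_def W_def weight_xi_def norm_mult ennreal_power ennreal_mult[symmetric] power_mult_distrib mult_ac split: prod.splits)
  also have "\<dots> = ennreal (c\<^sup>2) * (\<integral>\<^sup>+v. (ennreal (cmod (weight_xi s g v)))\<^sup>2 \<partial>lborel)"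
  proof (rule nn_integral_cmult)
    have "weight_xi s g = (\<lambda>v. of_real (\<bar>snd v\<bar> powr s) * g v)"
      by (auto simp: weight_xi_def fun_eq_iff)
    moreover have [measurable]: "(snd :: real \<times> real \<Rightarrow> real) \<in> borel_measurable borel"
      by (intro borel_measurable_continuous_onI continuous_intros)
    ultimately show "(\<lambda>v. (ennreal (cmod (weight_xi s g v)))\<^sup>2) \<in> borel_measurable lborel"
      by simp
  qed
  finally have "L2_norm_on D (dist_conv f g) \<le>
      enn_sqrt (X\<^sup>2 * (ennreal (c\<^sup>2) * (\<integral>\<^sup>+v. (ennreal (cmod (weight_xi s g v)))\<^sup>2 \<partial>lborel)))"
    unfolding L2_norm_on_def nn_integral_completion by (rule enn_sqrt_mono)
  also have "\<dots> = ennreal c * X * L2_norm_on UNIV (weight_xi s g)"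
    using c by (simp add: enn_sqrt_mult enn_sqrt_ennreal L2_norm_on_def nn_integral_completion mult_ac)
  also have "\<dots> \<le> ennreal c * Xhat_norm_fun 0 (1/2) F * L2_norm_on UNIV (weight_xi s g)"
    unfolding X_def
    by (intro mult_right_mono mult_left_mono Xhat_norm_fun_ge[OF supp a_def eq]) auto
  finally show ?thesis .
qed


section \<open>The bilinear estimates\<close>

lemma powr_half_powers:
  "(2 powr (real k / 4))\<^sup>2 = sqrt (2 ^ k)" "(2 powr (real k / 2))\<^sup>2 = 2 ^ k"
proof -
  have "(2 powr (real k / 2))\<^sup>2 = 2 powr real k"
    by (simp add: power2_eq_square powr_add[symmetric])
  then show "(2 powr (real k / 2))\<^sup>2 = 2 ^ k" by (simp add: powr_realpow)
  then have "sqrt (2 ^ k) = 2 powr (real k / 2)"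
    by (intro real_sqrt_unique) auto
  moreover have "(2 powr (real k / 4))\<^sup>2 = 2 powr (real k / 2)"
    by (simp add: power2_eq_square powr_add[symmetric])
  ultimately show "(2 powr (real k / 4))\<^sup>2 = sqrt (2 ^ k)" by simp
qed

lemma abs_powr_square:
  fixes x :: real
  assumes "x \<noteq> 0"
  shows "(\<bar>x\<bar> powr (-1/4))\<^sup>2 = 1 / sqrt \<bar>x\<bar>" "(\<bar>x\<bar> powr (-1/2))\<^sup>2 = 1 / \<bar>x\<bar>"
proof -
  have "(\<bar>x\<bar> powr (-1/4))\<^sup>2 = \<bar>x\<bar> powr (- (1/2))" "(\<bar>x\<bar> powr (-1/2))\<^sup>2 = \<bar>x\<bar> powr (- 1)"
    by (simp_all add: power2_eq_square powr_add[symmetric])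
  then show "(\<bar>x\<bar> powr (-1/4))\<^sup>2 = 1 / sqrt \<bar>x\<bar>" "(\<bar>x\<bar> powr (-1/2))\<^sup>2 = 1 / \<bar>x\<bar>"
    using assms by (simp_all add: powr_minus_divide powr_half_sqrt)
qed

text \<open>The Borel part is chosen inside \<open>\<Omega>\<close>, so that it inherits the conditions imposed on the points of \<open>\<Omega>\<close>.\<close>

lemma L2_norm_on_borel_part:
  assumes \<Omega>: "\<Omega> \<in> sets lebesgue"
  obtains \<Omega>' where "\<Omega>' \<in> sets borel" "\<Omega>' \<subseteq> \<Omega>" "\<And>B h. L2_norm_on (\<Omega> \<inter> B) h = L2_norm_on (\<Omega>' \<inter> B) h"
proof -
  obtain S N N' where N: "\<Omega> = S \<union> N" "N \<subseteq> N'" "N' \<in> null_sets lborel" "S \<in> sets lborel"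
    using \<Omega> by (rule sets_completionE)
  have "L2_norm_on (\<Omega> \<inter> B) h = L2_norm_on (S \<inter> B) h" for B h
    unfolding L2_norm_on_def nn_integral_completion
  proof (rule arg_cong[where f = enn_sqrt], rule nn_integral_cong_AE)
    show "AE z in lborel. (ennreal (cmod (h z)))\<^sup>2 * indicator (\<Omega> \<inter> B) z =
        (ennreal (cmod (h z)))\<^sup>2 * indicator (S \<inter> B) z"
      using AE_not_in[OF N(3)] by eventually_elim (use N(1,2) in \<open>auto simp: indicator_def\<close>)
  qed
  then show thesis using N by (intro that[of S]) auto
qed

text \<open>The constant is \<open>17 = sqrt 289\<close>. Both estimates are instances of \<open>weighted_convolution_estimate\<close>, with
  \<open>D = B_set k\<close> and with \<open>D\<close> the Borel part of \<open>\<Omega> \<inter> B_set k\<close>.\<close>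

theorem lemma2p5:
  shows "\<exists>C::real. C > 0 \<and>
    (\<forall>(f :: (real \<times> real \<Rightarrow> complex) \<Rightarrow> complex) (g :: real \<times> real \<Rightarrow> complex)
       (j::nat) (\<Omega> :: (real \<times> real) set).
       tempered_distribution f \<longrightarrow> schwartz g \<longrightarrow> dist_support f \<subseteq> A_set j \<longrightarrow>
       Xhat_norm 0 (1/2) f < \<infinity> \<longrightarrow>
       \<Omega> \<in> sets lebesgue \<longrightarrow> emeasure lebesgue \<Omega> > 0 \<longrightarrow>
       K4 \<Omega> (dist_support f) \<ge> 2 \<longrightarrow>
       (\<forall>\<tau> \<xi> \<tau>\<^sub>1 \<xi>\<^sub>1. (\<tau>, \<xi>) \<in> \<Omega> \<longrightarrow> (\<tau>\<^sub>1, \<xi>\<^sub>1) \<in> dist_support f \<longrightarrow>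
          (let \<xi>\<^sub>2 = \<xi> - \<xi>\<^sub>1 in
             \<xi> * \<xi>\<^sub>1 \<le> 0 \<and>
             (3 * \<xi> * \<xi>\<^sub>1 * \<xi>\<^sub>2\<^sup>2 \<noteq> 0 \<longrightarrow> \<bar>1 + 4 / (3 * \<xi> * \<xi>\<^sub>1 * \<xi>\<^sub>2\<^sup>2)\<bar> \<le> 1/2))) \<longrightarrow>
       (\<forall>k::nat.
          L2_norm_on (B_set k) (dist_conv f g)
            \<le> ennreal (C * 2 powr (k / 4)) * Xhat_norm 0 (1/2) f
                * L2_norm_on UNIV (weight_xi (-1/4) g) \<and>
          L2_norm_on (\<Omega> \<inter> B_set k) (dist_conv f g)
            \<le> ennreal (C * 2 powr (k / 2)) * inverse (enn_sqrt (K4 \<Omega> (dist_support f)))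
                * Xhat_norm 0 (1/2) f * L2_norm_on UNIV (weight_xi (-1/2) g)))"
proof (rule exI[of _ 17], intro conjI allI impI)
  show "(17::real) > 0" by simp
next
  fix f :: "(real \<times> real \<Rightarrow> complex) \<Rightarrow> complex" and g :: "real \<times> real \<Rightarrow> complex"
    and j k :: nat and \<Omega> :: "(real \<times> real) set"
  assume g: "schwartz g" and supp: "dist_support f \<subseteq> A_set j"
    and fin: "Xhat_norm 0 (1/2) f < \<infinity>"
    and \<Omega>: "\<Omega> \<in> sets lebesgue" "emeasure lebesgue \<Omega> > 0"
    and K4: "K4 \<Omega> (dist_support f) \<ge> 2"
    and cond: "\<forall>\<tau> \<xi> \<tau>\<^sub>1 \<xi>\<^sub>1. (\<tau>, \<xi>) \<in> \<Omega> \<longrightarrow> (\<tau>\<^sub>1, \<xi>\<^sub>1) \<in> dist_support f \<longrightarrow>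
          (let \<xi>\<^sub>2 = \<xi> - \<xi>\<^sub>1 in
             \<xi> * \<xi>\<^sub>1 \<le> 0 \<and>
             (3 * \<xi> * \<xi>\<^sub>1 * \<xi>\<^sub>2\<^sup>2 \<noteq> 0 \<longrightarrow> \<bar>1 + 4 / (3 * \<xi> * \<xi>\<^sub>1 * \<xi>\<^sub>2\<^sup>2)\<bar> \<le> 1/2))"
  let ?S = "dist_support f"
  have S [measurable]: "?S \<in> sets borel" using closed_dist_support by (rule borel_closed)
  have sgn: "\<xi> * \<xi>\<^sub>1 \<le> 0"
      and res: "3 * \<xi> * \<xi>\<^sub>1 * (\<xi> - \<xi>\<^sub>1)\<^sup>2 \<noteq> 0 \<Longrightarrow> \<bar>1 + 4 / (3 * \<xi> * \<xi>\<^sub>1 * (\<xi> - \<xi>\<^sub>1)\<^sup>2)\<bar> \<le> 1/2"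
      if "(\<tau>, \<xi>) \<in> \<Omega>" "(\<tau>\<^sub>1, \<xi>\<^sub>1) \<in> ?S" for \<tau> \<xi> \<tau>\<^sub>1 \<xi>\<^sub>1
    using cond that unfolding Let_def by blast+
  have K4_le: "K4 \<Omega> ?S \<le> ennreal \<bar>\<xi>\<^sub>1 + \<xi>\<bar>" if "(\<tau>, \<xi>) \<in> \<Omega>" "(\<tau>\<^sub>1, \<xi>\<^sub>1) \<in> ?S" for \<tau> \<xi> \<tau>\<^sub>1 \<xi>\<^sub>1
    unfolding K4_def using that by (intro Inf_lower) blast
  have far: "2 \<le> \<bar>\<xi>\<^sub>1 + \<xi>\<bar>" if "(\<tau>, \<xi>) \<in> \<Omega>" "(\<tau>\<^sub>1, \<xi>\<^sub>1) \<in> ?S" for \<tau> \<xi> \<tau>\<^sub>1 \<xi>\<^sub>1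
  proof -
    have "ennreal 2 \<le> ennreal \<bar>\<xi>\<^sub>1 + \<xi>\<bar>" using order_trans[OF K4 K4_le[OF that]] by simp
    then show ?thesis by (simp only: ennreal_le_iff abs_ge_zero)
  qed
  obtain F where F: "represents F f"
    using fin unfolding Xhat_norm_def by (auto simp: INF_less_iff)
  have X: "Xhat_norm 0 (1/2) f = Xhat_norm_fun 0 (1/2) F" by (rule Xhat_norm_eq[OF F])
  \<comment> \<open>A single point of \<open>\<Omega>\<close> off the null line \<open>\<xi> = 0\<close> constrains the whole support of \<open>f\<close>.\<close>
  have "\<exists>v\<in>\<Omega>. snd v \<noteq> 0"
  proof (rule ccontr)
    assume zero: "\<not> (\<exists>v\<in>\<Omega>. snd v \<noteq> 0)"
    have "AE v in lborel. v \<notin> \<Omega>" using AE_snd_nonzero by eventually_elim (use zero in blast)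
    then have "AE v in lebesgue. v \<notin> \<Omega>" by (rule AE_completion)
    then have "\<Omega> \<in> null_sets lebesgue" using \<Omega>(1) by (simp add: AE_iff_null_sets)
    with \<Omega>(2) show False by (simp add: null_setsD1)
  qed
  then obtain \<tau>\<^sub>0 \<xi>\<^sub>0 where w0: "(\<tau>\<^sub>0, \<xi>\<^sub>0) \<in> \<Omega>" "\<xi>\<^sub>0 \<noteq> 0" by force
  have gap: "\<bar>\<xi>\<^sub>1\<bar> \<le> 1/3 \<or> \<bar>\<xi>\<^sub>1\<bar> \<ge> 2" if "(\<tau>\<^sub>1, \<xi>\<^sub>1) \<in> ?S" for \<tau>\<^sub>1 \<xi>\<^sub>1
    by (rule resonance_frequency_gap[OF sgn[OF w0(1) that] w0(2) far[OF w0(1) that] res[OF w0(1) that]])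
  show "L2_norm_on (B_set k) (dist_conv f g)
      \<le> ennreal (17 * 2 powr (k / 4)) * Xhat_norm 0 (1/2) f * L2_norm_on UNIV (weight_xi (-1/4) g)"
    unfolding X
  proof (rule weighted_convolution_estimate[OF F g supp sets_B_set])
    fix l \<tau>\<^sub>2 and \<xi>\<^sub>2 :: real assume nz: "\<xi>\<^sub>2 \<noteq> 0"
    let ?E = "{w \<in> ?S \<inter> B_set l. w + (\<tau>\<^sub>2, \<xi>\<^sub>2) \<in> B_set k}"
    have "emeasure lborel ?E \<le> ennreal (2 ^ l) * ennreal (289 * sqrt (2 ^ k) / sqrt \<bar>\<xi>\<^sub>2\<bar>)"
    proof (rule resonant_measure_frequency_gap[OF _ _ _ nz])
      show "?E \<in> sets borel" by measurable
    qed (use gap in auto)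
    also have "289 * sqrt (2 ^ k) / sqrt \<bar>\<xi>\<^sub>2\<bar> = (17 * 2 powr (k / 4) * \<bar>\<xi>\<^sub>2\<bar> powr (-1/4))\<^sup>2"
      unfolding power_mult_distrib powr_half_powers abs_powr_square[OF nz] by simp
    finally show "emeasure lborel ?E
        \<le> ennreal (2 ^ l) * ennreal ((17 * 2 powr (k / 4) * \<bar>\<xi>\<^sub>2\<bar> powr (-1/4))\<^sup>2)" .
  qed simp
  obtain \<Omega>' where \<Omega>' [measurable]: "\<Omega>' \<in> sets borel" and sub: "\<Omega>' \<subseteq> \<Omega>"
      and L2: "\<And>B h. L2_norm_on (\<Omega> \<inter> B) h = L2_norm_on (\<Omega>' \<inter> B) h"
    using L2_norm_on_borel_part[OF \<Omega>(1)] by blast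
  have D: "\<Omega>' \<inter> B_set k \<in> sets borel" by measurable
  show "L2_norm_on (\<Omega> \<inter> B_set k) (dist_conv f g)
      \<le> ennreal (17 * 2 powr (k / 2)) * inverse (enn_sqrt (K4 \<Omega> ?S))
          * Xhat_norm 0 (1/2) f * L2_norm_on UNIV (weight_xi (-1/2) g)"
  proof (cases "K4 \<Omega> ?S")
    case (real \<kappa>)
    have "ennreal 2 \<le> ennreal \<kappa>" using K4 unfolding real(2) by simp
    then have \<kappa>: "\<kappa> \<ge> 2" using real(1) by (simp only: ennreal_le_iff)
    let ?c = "17 * 2 powr (k / 2) * (1 / sqrt \<kappa>)"
    have "L2_norm_on (\<Omega>' \<inter> B_set k) (dist_conv f g)
        \<le> ennreal ?c * Xhat_norm_fun 0 (1/2) F * L2_norm_on UNIV (weight_xi (-1/2) g)"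
    proof (rule weighted_convolution_estimate[OF F g supp D])
      fix l \<tau>\<^sub>2 and \<xi>\<^sub>2 :: real assume nz: "\<xi>\<^sub>2 \<noteq> 0"
      let ?E = "{w \<in> ?S \<inter> B_set l. w + (\<tau>\<^sub>2, \<xi>\<^sub>2) \<in> \<Omega>' \<inter> B_set k}"
      have "emeasure lborel ?E \<le> ennreal (2 ^ l) * ennreal (289 * 2 ^ k / \<kappa> / \<bar>\<xi>\<^sub>2\<bar>)"
      proof (rule resonant_measure_transversal[OF _ _ _ _ nz])
        show "?E \<in> sets borel" by measurable
        show "\<kappa> > 0" using \<kappa> by simp
        show "(\<tau>, \<xi>) \<in> B_set l \<and> (\<tau> + \<tau>\<^sub>2, \<xi> + \<xi>\<^sub>2) \<in> B_set k" if "(\<tau>, \<xi>) \<in> ?E" for \<tau> \<xi>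
          using that by auto
        fix \<tau> \<xi> assume w: "(\<tau>, \<xi>) \<in> ?E" and nz2: "\<xi> \<noteq> 0" "\<xi> + \<xi>\<^sub>2 \<noteq> 0"
        then have in1: "(\<tau> + \<tau>\<^sub>2, \<xi> + \<xi>\<^sub>2) \<in> \<Omega>" and in2: "(\<tau>, \<xi>) \<in> ?S" using sub by auto
        have "\<kappa> \<le> \<bar>\<xi> + (\<xi> + \<xi>\<^sub>2)\<bar>"
          using K4_le[OF in1 in2] unfolding real(2) by (simp only: ennreal_le_iff abs_ge_zero)
        also have "\<xi> + (\<xi> + \<xi>\<^sub>2) = 2 * \<xi> + \<xi>\<^sub>2" by simp
        finally have "\<kappa> \<le> \<bar>2 * \<xi> + \<xi>\<^sub>2\<bar>" .
        then show "\<xi> * (\<xi> + \<xi>\<^sub>2) < 0 \<and> - 1/2 \<le> \<xi> * (\<xi> + \<xi>\<^sub>2) \<and> \<kappa> \<le> \<bar>2 * \<xi> + \<xi>\<^sub>2\<bar>"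
          using resonance_small_product[OF sgn[OF in1 in2] nz2(2,1) far[OF in1 in2] res[OF in1 in2]]
          by (simp add: mult.commute)
      qed
      also have "289 * 2 ^ k / \<kappa> / \<bar>\<xi>\<^sub>2\<bar> = (?c * \<bar>\<xi>\<^sub>2\<bar> powr (-1/2))\<^sup>2"
        unfolding power_mult_distrib powr_half_powers abs_powr_square[OF nz] power_one_over
        using \<kappa> by simp
      finally show "emeasure lborel ?E \<le> ennreal (2 ^ l) * ennreal ((?c * \<bar>\<xi>\<^sub>2\<bar> powr (-1/2))\<^sup>2)" .
    qed (use \<kappa> in simp)
    moreover have "ennreal ?c = ennreal (17 * 2 powr (k / 2)) * inverse (enn_sqrt (K4 \<Omega> ?S))"
      using \<kappa> by (simp add: real(2) enn_sqrt_ennreal inverse_ennreal inverse_eq_divide ennreal_mult[symmetric])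
    ultimately show ?thesis by (simp only: L2 X)
  next
    case top
    \<comment> \<open>The infimum is infinite only over the empty set, so \<open>f\<close> has empty support and the estimate holds with constant 0.\<close>
    have "L2_norm_on (\<Omega>' \<inter> B_set k) (dist_conv f g)
        \<le> ennreal 0 * Xhat_norm_fun 0 (1/2) F * L2_norm_on UNIV (weight_xi (-1/2) g)"
    proof (rule weighted_convolution_estimate[OF F g supp D])
      fix l \<tau>\<^sub>2 and \<xi>\<^sub>2 :: real
      have "w \<notin> ?S" for w
      proof
        assume "w \<in> ?S"
        with K4_le[OF w0(1), of "fst w" "snd w"] show False unfolding top by (simp add: top_unique)
      qed
      then have "{w \<in> ?S \<inter> B_set l. w + (\<tau>\<^sub>2, \<xi>\<^sub>2) \<in> \<Omega>' \<inter> B_set k} = {}" by blast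
      then show "emeasure lborel {w \<in> ?S \<inter> B_set l. w + (\<tau>\<^sub>2, \<xi>\<^sub>2) \<in> \<Omega>' \<inter> B_set k}
          \<le> ennreal (2 ^ l) * ennreal ((0 * \<bar>\<xi>\<^sub>2\<bar> powr (-1/2))\<^sup>2)"
        by (simp only: emeasure_empty zero_le)
    qed simp
    then show ?thesis unfolding L2 by simp
  qed
qed

end
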